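(* Let $\Omega\subseteq\mathbb{R}^n$ be open and bounded, let $A\colon\Omega\to\mathcal{S}^n_+\setminus\{0\}$ and $f\colon\Omega\to\mathbb{R}$ be continuous, and suppose that for some $m\in\mathbb{N}$ there is a locally Lipschitz map $Q\colon\Omega\to\mathbb{R}^{n\times m}$ such that $$\frac{A(x)}{\|A(x)\|_1}=Q(x)Q^T(x)\qquad\text{for all }x\in\Omega.$$ Then the comparison principle holds for the equation $$\operatorname{tr}\big(A(x)\mathcal{H}w\big)=f(x)\qquad\text{in }\Omega.$$
   Context: $\mathcal{S}^n$ is the space of real symmetric $n\times n$ matrices, $\mathcal{S}^n_+$ the set of positive semidefinite ones; $\|X\|_1=\sum_{i=1}^n|\lambda_i(X)|$ is the trace norm ($\lambda_i(X)$ the eigenvalues of $X$); $\mathcal{H}w$ is the Hessian matrix of $w$. Write $F(X,x):=\operatorname{tr}(A(x)X)-f(x)$, so that the equation is $F(\mathcal{H}w,x)=0$. Viscosity solutions: $v\in USC(\overline\Omega)$ is a viscosity subsolution of $F(\mathcal{H}w,x)=0$ in $\Omega$ if, whenever $x_0\in\Omega$ and $\phi$ is a $C^2$ function near $x_0$ with $\phi(x_0)=v(x_0)$ and $\phi\ge v$ near $x_0$, then $F(\mathcal{H}\phi(x_0),x_0)\ge0$. $u\in LSC(\overline\Omega)$ is a viscosity supersolution if, whenever $\phi$ is $C^2$ near $x_0\in\Omega$ with $\phi(x_0)=u(x_0)$ and $\phi\le u$ near $x_0$, then $F(\mathcal{H}\phi(x_0),x_0)\le0$. ($USC$, $LSC$: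 real-valued upper/lower semicontinuous functions.) The comparison principle holds for the equation in $\Omega$ if: whenever $v\in USC(\overline\Omega)$ is a viscosity subsolution and $u\in LSC(\overline\Omega)$ is a viscosity supersolution in $\Omega$ with $v\le u$ on $\partial\Omega$, then $v\le u$ in $\Omega$. *)

theory Defs
  imports "HOL-Analysis.Analysis" "HOL-Computational_Algebra.Polynomial"
begin

definition sym_matrices :: "(real^'n^'n) set" where
  "sym_matrices = {X. transpose X = X}"

definition psd_matrices :: "(real^'n^'n) set" where
  "psd_matrices = {X \<in> sym_matrices. \<forall>v. 0 \<le> v \<bullet> (X *v v)}"

definition charpoly :: "real^'n^'n \<Rightarrow> real poly" where
  "charpoly X = det (\<chi> i j. (if i = j then [:0, 1:] else 0) - [:X $ i $ j:])"

text \<open>The roots of the characteristic polynomial are taken with multiplicity.  Only real roots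
  are counted, so this is the trace norm for symmetric matrices (all of whose eigenvalues are
  real), but not for arbitrary ones.\<close>

definition trace_norm :: "real^'n^'n \<Rightarrow> real" where
  "trace_norm X = (\<Sum>l\<in>#proots (charpoly X). \<bar>l\<bar>)"

definition locally_lipschitz_on ::
    "'a::metric_space set \<Rightarrow> ('a \<Rightarrow> 'b::metric_space) \<Rightarrow> bool" where
  "locally_lipschitz_on S f \<longleftrightarrow> (\<forall>x\<in>S. \<exists>r>0. \<exists>L. L-lipschitz_on (ball x r \<inter> S) f)"

definition usc_on :: "'a::topological_space set \<Rightarrow> ('a \<Rightarrow> real) \<Rightarrow> bool" where
  "usc_on S f \<longleftrightarrow> (\<forall>x\<in>S. \<forall>c. f x < c \<longrightarrow> (\<forall>\<^sub>F y in at x within S. f y < c))"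

definition lsc_on :: "'a::topological_space set \<Rightarrow> ('a \<Rightarrow> real) \<Rightarrow> bool" where
  "lsc_on S f \<longleftrightarrow> (\<forall>x\<in>S. \<forall>c. c < f x \<longrightarrow> (\<forall>\<^sub>F y in at x within S. c < f y))"

definition gradient :: "(real^'n \<Rightarrow> real) \<Rightarrow> real^'n \<Rightarrow> real^'n" where
  "gradient f x = (\<chi> i. frechet_derivative f (at x) (axis i 1))"

definition hessian :: "(real^'n \<Rightarrow> real) \<Rightarrow> real^'n \<Rightarrow> real^'n^'n" where
  "hessian f x = matrix (frechet_derivative (gradient f) (at x))"

definition C2_near :: "(real^'n \<Rightarrow> real) \<Rightarrow> real^'n \<Rightarrow> bool" where
  "C2_near f x0 \<longleftrightarrow> (\<exists>U. open U \<and> x0 \<in> U \<and> f differentiable_on U \<and>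
     gradient f differentiable_on U \<and> continuous_on U (hessian f))"

text \<open>Sub- and supersolutions are
  functions on \<open>closure \<Omega>\<close>; their values elsewhere play no role, and for \<open>x0\<close> in the open
  set \<open>\<Omega>\<close> the filter \<open>at x0 within \<Omega>\<close> together with equality at \<open>x0\<close> amounts to a full neighbourhood.\<close>

definition viscosity_subsolution ::
    "(real^'n^'n \<Rightarrow> real^'n \<Rightarrow> real) \<Rightarrow> (real^'n) set \<Rightarrow> (real^'n \<Rightarrow> real) \<Rightarrow> bool" where
  "viscosity_subsolution F \<Omega> v \<longleftrightarrow> usc_on (closure \<Omega>) v \<and>
     (\<forall>x0\<in>\<Omega>. \<forall>\<phi>. C2_near \<phi> x0 \<and> \<phi> x0 = v x0 \<and> (\<forall>\<^sub>F x in at x0 within \<Omega>. v x \<le> \<phi> x)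
        \<longrightarrow> F (hessian \<phi> x0) x0 \<ge> 0)"

definition viscosity_supersolution ::
    "(real^'n^'n \<Rightarrow> real^'n \<Rightarrow> real) \<Rightarrow> (real^'n) set \<Rightarrow> (real^'n \<Rightarrow> real) \<Rightarrow> bool" where
  "viscosity_supersolution F \<Omega> u \<longleftrightarrow> lsc_on (closure \<Omega>) u \<and>
     (\<forall>x0\<in>\<Omega>. \<forall>\<phi>. C2_near \<phi> x0 \<and> \<phi> x0 = u x0 \<and> (\<forall>\<^sub>F x in at x0 within \<Omega>. \<phi> x \<le> u x)
        \<longrightarrow> F (hessian \<phi> x0) x0 \<le> 0)"

definition comparison_principle ::
    "(real^'n^'n \<Rightarrow> real^'n \<Rightarrow> real) \<Rightarrow> (real^'n) set \<Rightarrow> bool" where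
  "comparison_principle F \<Omega> \<longleftrightarrow>
     (\<forall>v u. viscosity_subsolution F \<Omega> v \<and> viscosity_supersolution F \<Omega> u \<and>
        (\<forall>x\<in>frontier \<Omega>. v x \<le> u x) \<longrightarrow> (\<forall>x\<in>\<Omega>. v x \<le> u x))"

end

theory Submission
  imports Defs
begin

text \<open>Suppose \<open>v - u\<close> is positive somewhere.  Add \<open>\<epsilon> |x|\<^sup>2\<close> to \<open>v\<close>, double the variables with the
  penalty \<open>\<alpha> / 2 |x - y|\<^sup>2\<close>, and replace \<open>v\<close> and \<open>- u\<close> by their sup-convolutions, which are
  semiconvex.  The points at which the doubled function lies below an affine function of small slope
  touching it form a set whose image under the gradient contains a ball.  There the sup-convolutions
  agree with suitable concave envelopes, whose gradients are globally Lipschitz; hence that set is not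
  negligible, and by Rademacher's theorem the envelopes have a second order expansion at one of its
  points.  This takes the place of Alexandrov's theorem and Jensen's lemma.

  At such a point, test the resulting second order inequality in the directions \<open>(q\<^sub>k(\<xi>), q\<^sub>k(\<eta>))\<close>
  given by the columns of \<open>Q\<close> and sum over \<open>k\<close>.  The coupling contributes at most
  \<open>\<alpha> |Q(\<xi>) - Q(\<eta>)|\<^sup>2 \<le> L\<^sup>2 \<alpha> |\<xi> - \<eta>|\<^sup>2\<close>, which tends to \<open>0\<close> as \<open>\<alpha> \<rightarrow> \<infinity>\<close>, whereas \<open>\<epsilon> |x|\<^sup>2\<close>
  contributes \<open>2 \<epsilon> |Q|\<^sup>2\<close>, which stays positive in the limit.\<close>

section \<open>Rademacher's theorem\<close>

text \<open>A concave envelope of a semiconvex function is concave and keeps a lower bound on second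
  differences. Its gradient is therefore defined everywhere and Lipschitz, so differentiating that
  gradient by Rademacher's theorem yields the second order expansion. The expansion lives at a
  contact point \<open>(x, y)\<close> of the sup-convolutions, whereas the equation is tested at
  their maximisers \<xi> and \<eta>; the jets are carried there unchanged, and the distances
  involved enter the penalty. A second parameter \<kappa>, later 1 / \<alpha>, has three tasks: it
  makes the doubled function coercive on the whole space, bounds the slopes of the touching affine
  functions, and measures the error in the matrix inequality. The equation is divided by the trace
  norm so that the columns of \<open>Q\<close> appear. The right-hand side f / |A|_1 must then be
  continuous for its two values to cancel in the limit; it is written as f |Q|^2 / tr A, which
  avoids continuity of eigenvalues. The size of \<epsilon> is dictated by the boundary: \<epsilon>
  |x|^2 may use up at most half of the supposed positive value of \<open>v - u\<close>.\<close>

lemma lipschitz_real_AE_convergent_quotients: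
  fixes F :: "real \<Rightarrow> real"
  assumes F: "L-lipschitz_on UNIV F"
  shows "AE t in lborel. convergent (\<lambda>k. real (Suc k) * (F (t + 1 / real (Suc k)) - F t))"
proof -
  \<comment> \<open>The slopes of \<open>F\<close> lie between -L and L, so those of
    \<open>H\<close> lie between 1 and 2 L + 1: \<open>H\<close> is an increasing bijection and its
    inverse \<open>G\<close> is 1-Lipschitz. The linear term is removed again at the end.\<close>
  define H where "H t = F t + (L + 1) * t" for t
  have L0: "L \<ge> 0" using F lipschitz_on_nonneg by blast
  have FL: "\<bar>F b - F a\<bar> \<le> L * \<bar>b - a\<bar>" for a b
    using lipschitz_onD[OF F, of b a] by (simp add: dist_real_def)
  have H1: "b - a \<le> H b - H a" if "a \<le> b" for a b
    using FL[of b a] that by (auto simp: H_def algebra_simps abs_if split: if_splits)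
  have H2: "\<bar>H b - H a\<bar> \<le> (2 * L + 1) * \<bar>b - a\<bar>" for a b
  proof -
    have "\<bar>H b - H a\<bar> = \<bar>(F b - F a) + (L + 1) * (b - a)\<bar>"
      by (simp add: H_def algebra_simps)
    also have "\<dots> \<le> \<bar>F b - F a\<bar> + (L + 1) * \<bar>b - a\<bar>"
      using L0 by (simp add: abs_mult order_trans[OF abs_triangle_ineq])
    also have "\<dots> \<le> (2 * L + 1) * \<bar>b - a\<bar>"
      using FL[of b a] by (simp add: algebra_simps)
    finally show ?thesis .
  qed
  have mono: "strict_mono H"
    by (rule strict_monoI) (use H1 in \<open>smt (verit)\<close>)
  then have inj: "inj H" by (rule strict_mono_imp_inj_on)
  have "(2 * L + 1)-lipschitz_on UNIV H"
    by (rule lipschitz_onI) (use H2 L0 in \<open>auto simp: dist_real_def\<close>)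
  then have cont: "continuous_on UNIV H" by (rule lipschitz_on_continuous_on)
  have surj: "surj H"
  unfolding surj_def
  proof
    fix y :: real show "\<exists>x. y = H x"
    proof -
      define d where "d = \<bar>y - H 0\<bar>"
      have "H (- d) \<le> y" using H1[of "- d" 0] by (simp add: d_def)
      moreover have "y \<le> H d" using H1[of 0 d] by (simp add: d_def)
      moreover have "- d \<le> d" by (simp add: d_def)
      ultimately show ?thesis
        using IVT'[of H "- d" y d] continuous_on_subset[OF cont] by (metis subset_UNIV)
    qed
  qed
  define G where "G = inv H"
  have GH: "G (H t) = t" and HG: "H (G t) = t" for t
    using inj surj by (simp_all add: G_def surj_f_inv_f)
  have "1-lipschitz_on UNIV G"
  proof (rule lipschitz_onI)
    show "dist (G x) (G y) \<le> 1 * dist x y" for x y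
      using H1[of "G x" "G y"] H1[of "G y" "G x"] by (simp add: HG dist_real_def) linarith
  qed simp
  then have "continuous_on UNIV G" by (rule lipschitz_on_continuous_on)
  then have Gm[measurable]: "G \<in> borel_measurable borel"
    by (rule borel_measurable_continuous_onI)
  \<comment> \<open>As \<open>G\<close> inverts \<open>H\<close>, this measure gives a Borel set the
    Lebesgue measure of its image under \<open>H\<close>, in particular \<open>H b - H a\<close> to
    the interval from \<open>a\<close> to \<open>b\<close>.\<close>
  define M where "M = distr lborel borel G"
  have vimG: "G -` A = H ` A" for A
    by (auto simp: GH image_iff) (metis HG)
  have eM: "emeasure M A = emeasure lborel (H ` A)" if "A \<in> sets borel" for A
    unfolding M_def by (subst emeasure_distr) (use that in \<open>auto simp: vimG\<close>)
  \<comment> \<open>\<open>H\<close> is bi-Lipschitz, hence the image of Lebesgue measure under its inverse has a density, and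
    the Lebesgue differentiation theorem recovers the derivative of \<open>H\<close> from that density.\<close>
  have ac: "absolutely_continuous lborel M"
  proof (unfold absolutely_continuous_def, rule subsetI)
    fix A :: "real set" assume A: "A \<in> null_sets lborel"
    then have As: "A \<in> sets borel" by auto
    have "negligible A" using A
      by (simp add: negligible_iff_null_sets null_sets_completionI)
    then have "negligible (H ` A)"
    proof (rule negligible_locally_Lipschitz_image[rotated])
      fix x assume "x \<in> A"
      show "\<exists>T B. open T \<and> x \<in> T \<and> (\<forall>y\<in>A \<inter> T. norm (H y - H x) \<le> B * norm (y - x))"
        by (rule exI[of _ UNIV]) (use H2 in auto)
    qed auto
    moreover have "H ` A \<in> sets borel"
      using measurable_sets[OF Gm As] by (simp add: vimG)
    ultimately have "H ` A \<in> null_sets lborel"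
      by (simp add: negligible_iff_null_sets null_sets_completion_iff)
    then show "A \<in> null_sets M"
      using As by (auto simp: null_sets_def eM M_def[symmetric]) (simp add: M_def)
  qed
  define D where "D = RN_deriv lborel M"
  have D[measurable]: "D \<in> borel_measurable borel"
    using borel_measurable_RN_deriv[of lborel M] by (simp add: D_def)
  have dens: "density lborel D = M"
    unfolding D_def by (rule sigma_finite_measure.density_RN_deriv[OF sigma_finite_lborel ac]) (simp add: M_def)
  have Dint: "(\<integral>\<^sup>+x. D x * indicator {a..b} x \<partial>lborel) = ennreal (H b - H a)"
    if "a \<le> b" for a b
  proof -
    have "(\<integral>\<^sup>+x. D x * indicator {a..b} x \<partial>lborel) = emeasure M {a..b}"
      unfolding dens[symmetric] by (subst emeasure_density) auto
    also have "\<dots> = emeasure lborel (H ` {a..b})" by (simp add: eM)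
    also have "H ` {a..b} = {H a..H b}"
    proof (intro equalityI subsetI)
      fix y assume y: "y \<in> {H a..H b}"
      have "a \<le> G y" "G y \<le> b"
        using y strict_mono_less_eq[OF mono, of a "G y"] strict_mono_less_eq[OF mono, of "G y" b] by (auto simp: HG)
      then show "y \<in> H ` {a..b}" by (intro image_eqI[of _ _ "G y"]) (auto simp: HG)
    qed (auto simp: strict_mono_less_eq[OF mono])
    finally show ?thesis using H1[OF that] that by simp
  qed
  have fin: "AE x in lborel. D x \<noteq> \<infinity>"
  proof -
    have "AE x in lborel. D x * indicator {-real n..real n} x \<noteq> \<infinity>" for n
      by (rule nn_integral_PInf_AE) (auto simp: Dint)
    then have "AE x in lborel. \<forall>n. D x * indicator {-real n..real n} x \<noteq> \<infinity>"
      by (simp add: AE_all_countable)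
    then show ?thesis
    proof (eventually_elim)
      case (elim x)
      obtain n where "\<bar>x\<bar> \<le> real n" using real_arch_simple by blast
      then have "x \<in> {-real n..real n}" by auto
      then show ?case using elim[rule_format, of n] by simp
    qed
  qed
  define g where "g x = enn2real (D x)" for x
  have [measurable]: "g \<in> borel_measurable borel" unfolding g_def by measurable
  have gint: "(g has_integral (H b - H a)) {a..b}" if "a \<le> b" for a b
  proof -
    have "((\<lambda>x. indicator {a..b} x * g x) has_integral (H b - H a)) UNIV"
    proof (rule nn_integral_has_integral)
      have "(\<integral>\<^sup>+x. ennreal (indicator {a..b} x * g x) \<partial>lborel) = (\<integral>\<^sup>+x. D x * indicator {a..b} x \<partial>lborel)"
        by (rule nn_integral_cong_AE) (use fin in eventually_elim, auto simp: g_def indicator_def less_top)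
      then show "(\<integral>\<^sup>+x. ennreal (indicator {a..b} x * g x) \<partial>lborel) = ennreal (H b - H a)"
        by (simp add: Dint that)
    qed (use H1[OF that] that in \<open>auto simp: g_def\<close>)
    moreover have "(\<lambda>x. indicator {a..b} x * g x) = (\<lambda>x. if x \<in> {a..b} then g x else 0)"
      by (auto simp: indicator_def)
    ultimately show ?thesis by (simp only: has_integral_restrict_UNIV)
  qed
  have "g integrable_on cbox a b" for a b
    using gint[of a b] by (cases "a \<le> b") (auto simp: cbox_interval integrable_on_def)
  from integrable_ccontinuous_explicit[OF this] obtain N where N: "negligible N"
    and lim: "\<And>x e. \<lbrakk>x \<notin> N; 0 < e\<rbrakk> \<Longrightarrow> \<exists>d>0. \<forall>h. 0 < h \<and> h < d \<longrightarrow>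
        norm (integral (cbox x (x + h *\<^sub>R One)) g /\<^sub>R h ^ DIM(real) - g x) < e"
    by metis
  have "convergent (\<lambda>k. real (Suc k) * (F (t + 1 / real (Suc k)) - F t))" if "t \<notin> N" for t
  proof -
    have "(\<lambda>k. real (Suc k) * (H (t + 1 / real (Suc k)) - H t)) \<longlonglongrightarrow> g t"
    proof (rule LIMSEQ_I)
      fix e :: real assume "0 < e"
      from lim[OF that this] obtain d where "d > 0"
        and d: "\<And>h. 0 < h \<Longrightarrow> h < d \<Longrightarrow> \<bar>(H (t + h) - H t) / h - g t\<bar> < e"
        using integral_unique[OF gint[of t "t + _"]] by (force simp: divide_inverse_commute)
      obtain n where n: "1 / real (Suc n) < d"
        using \<open>d > 0\<close> nat_approx_posE by blast
      have "norm (real (Suc k) * (H (t + 1 / real (Suc k)) - H t) - g t) < e" if "k \<ge> n" for k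
      proof -
        have "1 / real (Suc k) < d"
          using n that by (smt (verit) frac_le of_nat_0_less_iff of_nat_le_iff zero_less_Suc Suc_le_mono)
        then show ?thesis using d[of "1 / real (Suc k)"] by (simp add: mult.commute)
      qed
      then show "\<exists>n. \<forall>k\<ge>n. norm (real (Suc k) * (H (t + 1 / real (Suc k)) - H t) - g t) < e" by blast
    qed
    then have "(\<lambda>k. real (Suc k) * (H (t + 1 / real (Suc k)) - H t) - (L + 1)) \<longlonglongrightarrow> g t - (L + 1)"
      by (intro tendsto_intros)
    moreover have "real (Suc k) * (H (t + 1 / real (Suc k)) - H t) - (L + 1)
        = real (Suc k) * (F (t + 1 / real (Suc k)) - F t)" for k
    proof -
      have "real (Suc k) * (1 / real (Suc k)) = 1" by simp
      then show ?thesis unfolding H_def by (simp only: distrib_left right_diff_distrib) (simp add: field_simps)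
    qed
    ultimately show ?thesis by (auto simp: convergent_def)
  qed
  then have "{t. \<not> convergent (\<lambda>k. real (Suc k) * (F (t + 1 / real (Suc k)) - F t))} \<subseteq> N" by blast
  then have "AE t in lebesgue. convergent (\<lambda>k. real (Suc k) * (F (t + 1 / real (Suc k)) - F t))"
    using N by (intro AE_I'[of N]) (auto simp: negligible_iff_null_sets)
  then show ?thesis
    by (subst (asm) AE_completion_iff) 
qed

section \<open>Directional difference quotients and their limits\<close>

definition diff_quot :: "('a::real_vector \<Rightarrow> real) \<Rightarrow> 'a \<Rightarrow> nat \<Rightarrow> 'a \<Rightarrow> real" where
  "diff_quot f d k x = real (Suc k) * (f (x + (1 / real (Suc k)) *\<^sub>R d) - f x)"

text \<open>An exact splitting, at the price of a base point shifted by \<open>d / (k + 1)\<close>.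
  The shift tends to 0 and is dealt with under an integral in
  \<open>lipschitz_AE_additive_lim_diff_quot\<close>.\<close>

lemma diff_quot_add:
  "diff_quot f (d + e) k x = diff_quot f e k (x + (1 / real (Suc k)) *\<^sub>R d) + diff_quot f d k x"
  by (simp add: diff_quot_def algebra_simps)

lemma abs_diff_quot_le:
  assumes "L-lipschitz_on UNIV (f :: 'a::real_normed_vector \<Rightarrow> real)"
  shows "\<bar>diff_quot f d k x\<bar> \<le> L * norm d"
proof -
  have "\<bar>f (x + (1 / real (Suc k)) *\<^sub>R d) - f x\<bar> \<le> L * norm ((1 / real (Suc k)) *\<^sub>R d)"
    using lipschitz_onD[OF assms, of "x + (1 / real (Suc k)) *\<^sub>R d" x] by (simp add: dist_norm)
  then have "real (Suc k) * \<bar>f (x + (1 / real (Suc k)) *\<^sub>R d) - f x\<bar> \<le> L * norm d"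
    by (simp add: field_simps)
  then show ?thesis by (simp add: diff_quot_def abs_mult)
qed

lemma measurable_diff_quot:
  assumes "L-lipschitz_on UNIV (f :: 'a::euclidean_space \<Rightarrow> real)"
  shows "diff_quot f d k \<in> borel_measurable borel"
proof -
  have c: "continuous_on UNIV f" by (rule lipschitz_on_continuous_on[OF assms])
  have "continuous_on UNIV (diff_quot f d k)"
    unfolding diff_quot_def
    by (intro continuous_intros continuous_on_compose2[OF c]) auto
  then show ?thesis by (rule borel_measurable_continuous_onI)
qed

lemma lipschitz_AE_convergent_diff_quot:
  fixes f :: "'a::euclidean_space \<Rightarrow> real"
  assumes f: "L-lipschitz_on UNIV f"
  shows "AE x in lborel. convergent (\<lambda>k. diff_quot f d k x)"
proof -
  note [measurable] = measurable_diff_quot[OF f, of d]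
  define B where "B = {x. \<not> convergent (\<lambda>k. diff_quot f d k x)}"
  have "{x \<in> space borel. Cauchy (\<lambda>k. diff_quot f d k x)} \<in> sets borel"
    by (rule sets_Collect_Cauchy) measurable
  then have "space borel - {x \<in> space borel. Cauchy (\<lambda>k. diff_quot f d k x)} \<in> sets borel"
    by (rule sets.compl_sets)
  moreover have "B = space borel - {x \<in> space borel. Cauchy (\<lambda>k. diff_quot f d k x)}"
    by (auto simp: B_def Cauchy_convergent_iff)
  ultimately have B[measurable]: "B \<in> sets borel" by simp
  have line: "AE t in lborel. x + t *\<^sub>R d \<notin> B" for x
  proof -
    have "(L * norm d)-lipschitz_on UNIV (\<lambda>t. f (x + t *\<^sub>R d))"
    proof (rule lipschitz_onI)
      show "dist (f (x + s *\<^sub>R d)) (f (x + t *\<^sub>R d)) \<le> L * norm d * dist s t" for s t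
        using lipschitz_onD[OF f, of "x + s *\<^sub>R d" "x + t *\<^sub>R d"]
        by (simp add: dist_norm algebra_simps flip: scaleR_diff_left)
    qed (use lipschitz_on_nonneg[OF f] in simp)
    from lipschitz_real_AE_convergent_quotients[OF this] show ?thesis
      by eventually_elim (simp add: B_def diff_quot_def algebra_simps)
  qed
  \<comment> \<open>By translation invariance, Fubini's theorem applies along lines in the arbitrary direction \<open>d\<close>.\<close>
  have "emeasure lborel B = (\<integral>\<^sup>+t. emeasure lborel B * indicator {0..1::real} t \<partial>lborel)"
    by (subst nn_integral_cmult_indicator) auto
  also have "\<dots> = (\<integral>\<^sup>+t. (\<integral>\<^sup>+x. indicator B (x + t *\<^sub>R d) * indicator {0..1::real} t \<partial>lborel) \<partial>lborel)"
  proof (rule nn_integral_cong)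
    fix t :: real
    have "emeasure lborel B = emeasure (distr lborel borel ((+) (t *\<^sub>R d))) B"
      by (simp add: lborel_distr_plus)
    also have "\<dots> = (\<integral>\<^sup>+x. indicator B x \<partial>distr lborel borel ((+) (t *\<^sub>R d)))" by simp
    also have "\<dots> = (\<integral>\<^sup>+x. indicator B (x + t *\<^sub>R d) \<partial>lborel)"
      by (subst nn_integral_distr) (auto simp: add.commute)
    finally show "emeasure lborel B * indicator {0..1::real} t
        = (\<integral>\<^sup>+x. indicator B (x + t *\<^sub>R d) * indicator {0..1::real} t \<partial>lborel)"
      by (simp add: nn_integral_multc)
  qed
  also have "\<dots> = (\<integral>\<^sup>+x. (\<integral>\<^sup>+t. indicator B (x + t *\<^sub>R d) * indicator {0..1::real} t \<partial>lborel) \<partial>lborel)"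
    by (rule lborel_pair.Fubini') measurable
  also have "\<dots> = (\<integral>\<^sup>+x. 0 \<partial>(lborel :: 'a measure))"
  proof (rule nn_integral_cong)
    fix x :: 'a
    show "(\<integral>\<^sup>+t. indicator B (x + t *\<^sub>R d) * indicator {0..1::real} t \<partial>lborel) = 0"
      by (subst nn_integral_0_iff_AE) (use line[of x] in \<open>auto simp: indicator_def\<close>)
  qed
  finally have "B \<in> null_sets lborel" by (simp add: null_sets_def)
  from AE_not_in[OF this] show ?thesis by eventually_elim (simp add: B_def)
qed

text \<open>By Lebesgue differentiation, almost every value of \<open>g\<close> is the limit of its
  averages over shrinking cubes with a corner at that point, and all these averages are 0.\<close>

lemma negligible_if_integral_cbox_zero:
  fixes g :: "'a::euclidean_space \<Rightarrow> real"
  assumes g: "\<And>a b. (g has_integral 0) (cbox a b)"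
  shows "negligible {x. g x \<noteq> 0}"
proof -
  have "g integrable_on cbox a b" for a b using g by blast
  from integrable_ccontinuous_explicit[OF this] obtain N where N: "negligible N"
    and lim: "\<And>x e. \<lbrakk>x \<notin> N; 0 < e\<rbrakk> \<Longrightarrow> \<exists>d>0. \<forall>h. 0 < h \<and> h < d \<longrightarrow>
        norm (integral (cbox x (x + h *\<^sub>R One)) g /\<^sub>R h ^ DIM('a) - g x) < e"
    by metis
  have "g x = 0" if x: "x \<notin> N" for x
  proof (rule ccontr)
    assume "g x \<noteq> 0"
    then have "0 < \<bar>g x\<bar>" by simp
    from lim[OF x this] obtain d where "d > 0"
      "\<And>h. 0 < h \<Longrightarrow> h < d \<Longrightarrow> norm (integral (cbox x (x + h *\<^sub>R One)) g /\<^sub>R h ^ DIM('a) - g x) < \<bar>g x\<bar>"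
      by blast
    from this(2)[of "d/2"] this(1) show False using integral_unique[OF g] by simp
  qed
  then have "{x. g x \<noteq> 0} \<subseteq> N" by blast
  with N show ?thesis by (rule negligible_subset)
qed

text \<open>Pointwise, the quotient at the shifted base point in \<open>diff_quot_add\<close> need
  not approach the one at \<open>x\<close>. Integrated over a box, however, the shift moves to the
  indicator of the box by translation invariance, and dominated convergence applies. So the defect
  of additivity has integral 0 over every box.\<close>

lemma lipschitz_AE_additive_lim_diff_quot:
  fixes f :: "'a::euclidean_space \<Rightarrow> real"
  assumes f: "L-lipschitz_on UNIV f"
  shows "AE x in lborel. lim (\<lambda>k. diff_quot f (d + e) k x)
      = lim (\<lambda>k. diff_quot f d k x) + lim (\<lambda>k. diff_quot f e k x)"
proof -
  note [measurable] = measurable_diff_quot[OF f]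
  define G where "G d x = lim (\<lambda>k. diff_quot f d k x)" for d x
  have Gm[measurable]: "G d \<in> borel_measurable borel" for d
    unfolding G_def by (rule borel_measurable_lim_metric) measurable
  have Glim: "AE x in lborel. (\<lambda>k. diff_quot f d k x) \<longlonglongrightarrow> G d x" for d
    using lipschitz_AE_convergent_diff_quot[OF f, of d]
    by eventually_elim (simp add: G_def convergent_LIMSEQ_iff)
  have indI: "integrable lborel (\<lambda>x. c * indicator (cbox a b) x)" for c :: real and a b :: 'a
    by (intro integrable_mult_right integrable_real_indicator)
      (auto intro!: emeasure_bounded_finite simp flip: infinity_ennreal_def)
  have S1: "(\<lambda>k. \<integral>x. indicator (cbox a b) x * diff_quot f d k x \<partial>lborel)
        \<longlonglongrightarrow> (\<integral>x. indicator (cbox a b) x * G d x \<partial>lborel)"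
    and I1: "integrable lborel (\<lambda>x. indicator (cbox a b) x * G d x)"
    and J1: "integrable lborel (\<lambda>x. indicator (cbox a b) x * diff_quot f d k x)"
    for a b d k
  proof -
    have m: "(\<lambda>x. indicator (cbox a b) x * G d x) \<in> borel_measurable lborel"
      "\<And>k. (\<lambda>x. indicator (cbox a b) x * diff_quot f d k x) \<in> borel_measurable lborel"
      by measurable
    have l: "AE x in lborel. (\<lambda>k. indicator (cbox a b) x * diff_quot f d k x) \<longlonglongrightarrow> indicator (cbox a b) x * G d x"
      using Glim[of d] by eventually_elim (intro tendsto_intros)
    have b: "\<And>k. AE x in lborel. norm (indicator (cbox a b) x * diff_quot f d k x)
        \<le> (L * norm d) * indicator (cbox a b) x"
      using abs_diff_quot_le[OF f, of d] by (auto simp: indicator_def)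
    show "(\<lambda>k. \<integral>x. indicator (cbox a b) x * diff_quot f d k x \<partial>lborel)
        \<longlonglongrightarrow> (\<integral>x. indicator (cbox a b) x * G d x \<partial>lborel)"
      by (rule integral_dominated_convergence[OF m indI l b])
    show "integrable lborel (\<lambda>x. indicator (cbox a b) x * G d x)"
      by (rule integrable_dominated_convergence[OF m indI l b])
    show "integrable lborel (\<lambda>x. indicator (cbox a b) x * diff_quot f d k x)"
      by (rule integrable_dominated_convergence2[OF m indI l b])
  qed
  define s where "s k = (1 / real (Suc k)) *\<^sub>R d" for k
  have s0: "s \<longlonglongrightarrow> 0"
    unfolding s_def using tendsto_scaleR[OF LIMSEQ_Suc[OF lim_1_over_n] tendsto_const, of d] by simp
  have S2: "(\<lambda>k. \<integral>x. indicator (cbox a b) x * diff_quot f e k (x + s k) \<partial>lborel)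
        \<longlonglongrightarrow> (\<integral>x. indicator (cbox a b) x * G e x \<partial>lborel)" for a b
  proof -
    \<comment> \<open>Off the boundary of the box, the shifted indicators are eventually equal to
      the unshifted one.\<close>
    have "cbox a b - box a b \<in> null_sets lborel"
      using negligible_frontier_interval[of a b]
      by (simp add: negligible_iff_null_sets null_sets_completion_iff)
    from AE_not_in[OF this] Glim[of e]
    have "AE x in lborel. (\<lambda>k. indicator (cbox a b) (x - s k) * diff_quot f e k x) \<longlonglongrightarrow> indicator (cbox a b) x * G e x"
    proof eventually_elim
      case (elim x)
      have xs: "(\<lambda>k. x - s k) \<longlonglongrightarrow> x" using tendsto_diff[OF tendsto_const s0, of x] by simp
      have "\<forall>\<^sub>F k in sequentially. indicator (cbox a b) (x - s k) = (indicator (cbox a b) x :: real)"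
      proof (cases "x \<in> box a b")
        case True
        then have "\<forall>\<^sub>F k in sequentially. x - s k \<in> box a b"
          using topological_tendstoD[OF xs open_box] by blast
        then show ?thesis
          by eventually_elim (use True box_subset_cbox in \<open>auto simp: indicator_def\<close>)
      next
        case False
        with elim have "x \<in> - cbox a b" by blast
        moreover have "open (- cbox a b)" by (simp only: open_Compl closed_cbox)
        ultimately have "\<forall>\<^sub>F k in sequentially. x - s k \<in> - cbox a b"
          using topological_tendstoD[OF xs] by blast
        then show ?thesis
          by eventually_elim (use \<open>x \<in> - cbox a b\<close> in \<open>auto simp: indicator_def\<close>)
      qed
      then have "(\<lambda>k. indicator (cbox a b) (x - s k) :: real) \<longlonglongrightarrow> indicator (cbox a b) x"
        by (rule tendsto_eventually)
      then show ?case using elim by (intro tendsto_intros)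
    qed
    moreover
    have sb: "norm (s k) \<le> norm d" for k
      using mult_right_mono[of 1 "1 + real k" "norm d"] by (simp add: s_def divide_le_eq mult.commute)
    \<comment> \<open>All shifts have norm at most \<open>norm d\<close>, so a single ball of radius
      \<open>R + norm d\<close> contains every shifted box and provides the dominating
      function.\<close>
    obtain R where R: "cbox a b \<subseteq> ball 0 R"
      using bounded_subset_ballD[OF bounded_cbox] by blast
    have "AE x in lborel. norm (indicator (cbox a b) (x - s k) * diff_quot f e k x)
        \<le> (L * norm e) * indicator (ball 0 (R + norm d)) x" for k
    proof (rule AE_I2)
      fix x
      have "x \<in> ball 0 (R + norm d)" if "x - s k \<in> cbox a b"
      proof -
        have "norm (x - s k) < R" using R that by auto
        then show ?thesis using sb[of k] norm_triangle_sub[of x "s k"] by auto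
      qed
      then show "norm (indicator (cbox a b) (x - s k) * diff_quot f e k x)
        \<le> (L * norm e) * indicator (ball 0 (R + norm d)) x"
        using abs_diff_quot_le[OF f, of e k x] lipschitz_on_nonneg[OF f]
        by (cases "x - s k \<in> cbox a b") (simp_all add: indicator_def)
    qed
    moreover have "integrable lborel (\<lambda>x::'a. (L * norm e) * indicator (ball 0 (R + norm d)) x :: real)"
      by (intro integrable_mult_right integrable_real_indicator)
        (auto intro!: emeasure_bounded_finite simp flip: infinity_ennreal_def)
    ultimately have "(\<lambda>k. \<integral>x. indicator (cbox a b) (x - s k) * diff_quot f e k x \<partial>lborel)
        \<longlonglongrightarrow> (\<integral>x. indicator (cbox a b) x * G e x \<partial>lborel)"
      by (intro integral_dominated_convergence[where w = "\<lambda>x. (L * norm e) * indicator (ball 0 (R + norm d)) x"])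
        measurable
    moreover have "(\<integral>x. indicator (cbox a b) (x - s k) * diff_quot f e k x \<partial>lborel)
        = (\<integral>x. indicator (cbox a b) x * diff_quot f e k (x + s k) \<partial>lborel)" for k
    proof -
      have "(\<integral>x. indicator (cbox a b) (x - s k) * diff_quot f e k x \<partial>lborel)
        = (\<integral>x. indicator (cbox a b) (x - s k) * diff_quot f e k x \<partial>distr lborel borel ((+) (s k)))"
        by (simp add: lborel_distr_plus)
      also have "\<dots> = (\<integral>x. indicator (cbox a b) x * diff_quot f e k (x + s k) \<partial>lborel)"
        by (subst integral_distr) (auto simp: add.commute)
      finally show ?thesis .
    qed
    ultimately show ?thesis by simp
  qed
  define g where "g x = G (d + e) x - G d x - G e x" for x
  have "(g has_integral 0) (cbox a b)" for a b
  proof -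
    let ?i = "\<lambda>x. indicator (cbox a b) x :: real"
    have J2: "integrable lborel (\<lambda>x. ?i x * diff_quot f e k (x + s k))" for k
    proof -
      have "integrable lborel (\<lambda>x. ?i x * diff_quot f (d + e) k x - ?i x * diff_quot f d k x)"
        by (intro Bochner_Integration.integrable_diff J1)
      then show ?thesis by (simp add: diff_quot_add s_def algebra_simps)
    qed
    have "(\<integral>x. ?i x * diff_quot f (d + e) k x \<partial>lborel)
        = (\<integral>x. ?i x * diff_quot f e k (x + s k) \<partial>lborel) + (\<integral>x. ?i x * diff_quot f d k x \<partial>lborel)" for k
      by (subst Bochner_Integration.integral_add[symmetric, OF J2 J1])
        (simp add: diff_quot_add s_def algebra_simps)
    then have "(\<lambda>k. \<integral>x. ?i x * diff_quot f (d + e) k x \<partial>lborel)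
        \<longlonglongrightarrow> (\<integral>x. ?i x * G e x \<partial>lborel) + (\<integral>x. ?i x * G d x \<partial>lborel)"
      by (simp only:) (intro tendsto_add S1 S2)
    from LIMSEQ_unique[OF this S1]
    have eq: "(\<integral>x. ?i x * G (d + e) x \<partial>lborel) = (\<integral>x. ?i x * G e x \<partial>lborel) + (\<integral>x. ?i x * G d x \<partial>lborel)"
      by simp
    have "integrable lborel (\<lambda>x. ?i x * G (d + e) x - ?i x * G d x - ?i x * G e x)"
      by (intro Bochner_Integration.integrable_diff I1)
    moreover have "(\<integral>x. ?i x * G (d + e) x - ?i x * G d x - ?i x * G e x \<partial>lborel) = 0"
      using eq by (simp add: Bochner_Integration.integral_diff I1 Bochner_Integration.integrable_diff)
    ultimately have "((\<lambda>x. ?i x * G (d + e) x - ?i x * G d x - ?i x * G e x) has_integral 0) UNIV"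
      using has_integral_integral_lborel by metis
    moreover have "(\<lambda>x. ?i x * G (d + e) x - ?i x * G d x - ?i x * G e x) = (\<lambda>x. if x \<in> cbox a b then g x else 0)"
      by (auto simp: g_def)
    ultimately show ?thesis by (simp only: has_integral_restrict_UNIV)
  qed
  from negligible_if_integral_cbox_zero[OF this] have "negligible {x. g x \<noteq> 0}" .
  moreover have "{x. g x \<noteq> 0} \<in> sets borel"
    unfolding g_def by measurable
  ultimately have "{x. g x \<noteq> 0} \<in> null_sets lborel"
    by (simp add: negligible_iff_null_sets null_sets_completion_iff)
  from AE_not_in[OF this] show ?thesis
    by eventually_elim (simp add: g_def G_def algebra_simps)
qed

text \<open>These are the test directions for differentiability: a countable family, so that the
  exceptional null sets can be united; closed under addition; finite in every ball; and after
  division by a large integer arbitrarily fine.\<close>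

definition lattice_points :: "'a::euclidean_space set" where
  "lattice_points = {d. \<forall>b\<in>Basis. d \<bullet> b \<in> \<int>}"

definition lattice_comb :: "('a::euclidean_space \<Rightarrow> int) \<Rightarrow> 'a" where
  "lattice_comb n = (\<Sum>b\<in>Basis. of_int (n b) *\<^sub>R b)"

lemma lattice_comb_floor:
  assumes "d \<in> lattice_points"
  shows "lattice_comb (restrict (\<lambda>b. \<lfloor>d \<bullet> b\<rfloor>) Basis) = d"
proof -
  have "lattice_comb (restrict (\<lambda>b. \<lfloor>d \<bullet> b\<rfloor>) Basis) = (\<Sum>b\<in>Basis. (d \<bullet> b) *\<^sub>R b)"
    unfolding lattice_comb_def using assms by (intro sum.cong) (auto simp: lattice_points_def)
  then show ?thesis by (simp add: euclidean_representation)
qed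

lemma countable_lattice_points: "countable (lattice_points :: 'a::euclidean_space set)"
proof -
  have "countable (lattice_comb ` (\<Pi>\<^sub>E b\<in>(Basis::'a set). (UNIV::int set)))"
    by (intro countable_image countable_PiE) auto
  moreover have "lattice_points \<subseteq> lattice_comb ` (\<Pi>\<^sub>E b\<in>(Basis::'a set). (UNIV::int set))"
  proof
    fix d :: 'a assume "d \<in> lattice_points"
    then show "d \<in> lattice_comb ` (\<Pi>\<^sub>E b\<in>Basis. UNIV)"
      by (intro image_eqI[where x = "restrict (\<lambda>b. \<lfloor>d \<bullet> b\<rfloor>) Basis"]) (auto simp: lattice_comb_floor)
  qed
  ultimately show ?thesis by (rule countable_subset[rotated])
qed

lemma finite_bounded_lattice_points: "finite {d \<in> lattice_points. norm (d::'a::euclidean_space) \<le> r}"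
proof -
  have "finite (lattice_comb ` (\<Pi>\<^sub>E b\<in>(Basis::'a set). {-\<lceil>r\<rceil>..\<lceil>r\<rceil>}))"
    by (intro finite_imageI finite_PiE) auto
  moreover have "{d \<in> lattice_points. norm d \<le> r} \<subseteq> lattice_comb ` (\<Pi>\<^sub>E b\<in>(Basis::'a set). {-\<lceil>r\<rceil>..\<lceil>r\<rceil>})"
  proof
    fix d :: 'a assume d: "d \<in> {d \<in> lattice_points. norm d \<le> r}"
    have "\<lfloor>d \<bullet> b\<rfloor> \<in> {-\<lceil>r\<rceil>..\<lceil>r\<rceil>}" if "b \<in> Basis" for b
    proof -
      have "\<bar>d \<bullet> b\<bar> \<le> r" using Basis_le_norm[OF that, of d] d by auto
      then show ?thesis by (auto simp: le_floor_iff floor_le_iff) linarith+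
    qed
    then show "d \<in> lattice_comb ` (\<Pi>\<^sub>E b\<in>Basis. {-\<lceil>r\<rceil>..\<lceil>r\<rceil>})"
      using d by (intro image_eqI[where x = "restrict (\<lambda>b. \<lfloor>d \<bullet> b\<rfloor>) Basis"]) (auto simp: lattice_comb_floor)
  qed
  ultimately show ?thesis by (rule finite_subset[rotated])
qed

lemma lattice_points_add: "d \<in> lattice_points \<Longrightarrow> e \<in> lattice_points \<Longrightarrow> d + e \<in> lattice_points"
  by (auto simp: lattice_points_def inner_add_left)

lemma lattice_points_scaleR_Basis: "b \<in> Basis \<Longrightarrow> of_int m *\<^sub>R b \<in> lattice_points"
  by (auto simp: lattice_points_def inner_Basis)

text \<open>Additivity forces homogeneity under integer factors, by induction in both directions,
  and lattice points are integer combinations of the basis. The vector paired with \<open>d\<close>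
  is the future gradient.\<close>

lemma additive_on_lattice_points:
  fixes G :: "'a::euclidean_space \<Rightarrow> real"
  assumes add: "\<And>d e. d \<in> lattice_points \<Longrightarrow> e \<in> lattice_points \<Longrightarrow> G (d + e) = G d + G e"
    and d: "d \<in> lattice_points"
  shows "G d = (\<Sum>b\<in>Basis. G b *\<^sub>R b) \<bullet> d"
proof -
  have z: "(0::'a) \<in> lattice_points" by (simp add: lattice_points_def)
  have G0: "G 0 = 0" using add[OF z z] by simp
  have mult: "G (of_int m *\<^sub>R b) = of_int m * G b" if b: "b \<in> Basis" for m b
  proof (induction m rule: int_induct[where k = 0])
    case (step1 i)
    have "G (of_int (i + 1) *\<^sub>R b) = G (of_int i *\<^sub>R b) + G (of_int 1 *\<^sub>R b)"
      using add[OF lattice_points_scaleR_Basis[OF b, of i] lattice_points_scaleR_Basis[OF b, of 1]]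
      by (simp add: algebra_simps)
    then show ?case using step1 by (simp add: algebra_simps)
  next
    case (step2 i)
    have "G (of_int i *\<^sub>R b) = G (of_int (i - 1) *\<^sub>R b) + G (of_int 1 *\<^sub>R b)"
      using add[OF lattice_points_scaleR_Basis[OF b, of "i - 1"] lattice_points_scaleR_Basis[OF b, of 1]]
      by (simp add: algebra_simps)
    then show ?case using step2 by (simp add: algebra_simps)
  qed (simp add: G0)
  have "(\<Sum>b\<in>S. (d \<bullet> b) *\<^sub>R b) \<in> lattice_points \<and> G (\<Sum>b\<in>S. (d \<bullet> b) *\<^sub>R b) = (\<Sum>b\<in>S. (d \<bullet> b) * G b)"
    if "finite S" "S \<subseteq> Basis" for S
    using that
  proof (induction S)
    case (insert b S)
    then have b: "b \<in> Basis" by simp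
    obtain m where m: "d \<bullet> b = of_int m" using d b by (auto simp: lattice_points_def elim: Ints_cases)
    show ?case
      using insert add[OF lattice_points_scaleR_Basis[OF b, of m]] lattice_points_add[OF lattice_points_scaleR_Basis[OF b, of m]]
      by (simp add: m mult[OF b])
  qed (simp add: G0 z)
  from this[of Basis] have "G d = (\<Sum>b\<in>Basis. (d \<bullet> b) * G b)"
    by (simp add: euclidean_representation)
  then show ?thesis
    unfolding inner_sum_left inner_scaleR_left by (simp add: inner_commute mult.commute)
qed

text \<open>Outside one null set the limits along all lattice directions exist and are given by a
  single vector \<open>l\<close>. An arbitrary increment is compared with a lattice point divided by
  \<open>K = k + 1\<close>. The Lipschitz bound pays for the difference, and finiteness of the
  directions involved makes the convergence uniform.\<close>

theorem lipschitz_AE_differentiable: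
  fixes f :: "'a::euclidean_space \<Rightarrow> real"
  assumes f: "L-lipschitz_on UNIV f"
  shows "AE x in lborel. f differentiable (at x)"
proof -
  have "AE x in lborel. \<forall>d\<in>lattice_points. convergent (\<lambda>k. diff_quot f d k x)"
    by (subst AE_ball_countable[OF countable_lattice_points])
      (use lipschitz_AE_convergent_diff_quot[OF f] in blast)
  moreover have "AE x in lborel. \<forall>d\<in>lattice_points. \<forall>e\<in>lattice_points.
      lim (\<lambda>k. diff_quot f (d + e) k x) = lim (\<lambda>k. diff_quot f d k x) + lim (\<lambda>k. diff_quot f e k x)"
    by (subst AE_ball_countable[OF countable_lattice_points], rule ballI,
        subst AE_ball_countable[OF countable_lattice_points])
      (use lipschitz_AE_additive_lim_diff_quot[OF f] in blast)
  ultimately show ?thesis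
  proof eventually_elim
    case (elim x)
    define G where "G d = lim (\<lambda>k. diff_quot f d k x)" for d
    define l where "l = (\<Sum>b\<in>Basis. G b *\<^sub>R b)"
    have lim: "(\<lambda>k. diff_quot f d k x) \<longlonglongrightarrow> l \<bullet> d" if "d \<in> lattice_points" for d
    proof -
      have "G d = l \<bullet> d"
        unfolding l_def by (rule additive_on_lattice_points) (use elim that in \<open>auto simp: G_def\<close>)
      then show ?thesis using elim that by (auto simp: G_def convergent_LIMSEQ_iff)
    qed
    have L0: "L \<ge> 0" using f lipschitz_on_nonneg by blast
    have "(f has_derivative (\<lambda>h. l \<bullet> h)) (at x)"
    proof (unfold has_derivative_at_alt, intro conjI allI impI)
      show "bounded_linear (\<lambda>h. l \<bullet> h)" by (rule bounded_linear_inner_right)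
      fix e :: real assume e: "0 < e"
      define N where "N = real DIM('a)"
      \<comment> \<open>\<open>C / K\<close> collects the three errors: replacing \<open>h\<close>
        by \<open>d / K\<close> in \<open>f\<close> and in the linear part, each time off by at most
        \<open>N / K\<close>, and the error of the difference quotient, at most
        \<open>1 / K\<close>. With \<open>m = C / e\<close>, the bound
        \<open>K * norm h \<ge> m\<close> turns this into \<open>e * norm h\<close>.\<close>
      define C where "C = (L + norm l) * N + 1"
      have C: "C > 0" using L0 by (simp add: C_def N_def add_nonneg_pos)
      define m where "m = C / e"
      have m: "m > 0" using C e by (simp add: m_def)
      define S where "S = {d \<in> lattice_points. norm (d::'a) \<le> m + 1 + N}"
      have finS: "finite S" unfolding S_def by (rule finite_bounded_lattice_points)
      have "\<forall>\<^sub>F k in sequentially. \<bar>diff_quot f d k x - l \<bullet> d\<bar> < 1" if "d \<in> S" for d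
        using tendstoD[OF lim, of d 1] that by (simp add: S_def dist_real_def)
      then have "\<forall>\<^sub>F k in sequentially. \<forall>d\<in>S. \<bar>diff_quot f d k x - l \<bullet> d\<bar> < 1"
        using finS by (simp add: eventually_ball_finite)
      then obtain K0 where K0: "\<And>k d. k \<ge> K0 \<Longrightarrow> d \<in> S \<Longrightarrow> \<bar>diff_quot f d k x - l \<bullet> d\<bar> < 1"
        by (auto simp: eventually_sequentially)
      \<comment> \<open>The bound 1 gives \<open>K * norm h \<le> m + 1\<close>, which keeps
        \<open>d\<close> in the finite set \<open>S\<close>; the other bound makes the index
        \<open>k\<close> at least \<open>K0\<close>.\<close>
      define \<delta> where "\<delta> = min 1 (m / (real K0 + 1))"
      have \<delta>: "\<delta> > 0" using m by (simp add: \<delta>_def)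
      have main: "\<bar>f (x + h) - f x - l \<bullet> h\<bar> \<le> e * norm h" if h: "norm h < \<delta>" for h
      proof (cases "h = 0")
        case False
        then have hp: "norm h > 0" by simp
        define k where "k = nat \<lceil>m / norm h\<rceil> - 1"
        have mh: "m / norm h > real K0 + 1"
        proof -
          have "norm h < m / (real K0 + 1)" using h by (simp add: \<delta>_def)
          then show ?thesis using hp by (simp add: field_simps)
        qed
        then have "\<lceil>m / norm h\<rceil> > int K0 + 1" by linarith
        then have Sk: "real (Suc k) = of_int \<lceil>m / norm h\<rceil>" and kK: "k \<ge> K0"
          by (auto simp: k_def of_nat_diff)
        define K where "K = real (Suc k)"
        have K1: "m \<le> K * norm h" "K * norm h \<le> m + 1"
        proof -
          have "m / norm h \<le> K" "K < m / norm h + 1" unfolding K_def Sk by linarith+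
          then have "m \<le> K * norm h" "K * norm h < m + norm h"
            using hp by (simp_all add: field_simps)
          then show "m \<le> K * norm h" "K * norm h \<le> m + 1" using h by (auto simp: \<delta>_def)
        qed
        have Kp: "K > 0" by (simp add: K_def)
        \<comment> \<open>\<open>h\<close> is \<open>d / K\<close> up to a relative error of order \<open>N / m\<close>, with \<open>d\<close> in the finite set \<open>S\<close>.\<close>
        define d where "d = (\<Sum>b\<in>Basis. of_int \<lfloor>K * (h \<bullet> b)\<rfloor> *\<^sub>R b)"
        have dlat: "d \<in> lattice_points"
          by (auto simp: lattice_points_def d_def inner_sum_left_Basis)
        have dist: "norm (K *\<^sub>R h - d) \<le> N"
        proof -
          have "norm (K *\<^sub>R h - d) \<le> (\<Sum>b\<in>Basis. \<bar>(K *\<^sub>R h - d) \<bullet> b\<bar>)" by (rule norm_le_l1)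
          also have "\<dots> \<le> (\<Sum>b\<in>(Basis::'a set). 1)"
          proof (rule sum_mono)
            fix b :: 'a assume "b \<in> Basis"
            then have "(K *\<^sub>R h - d) \<bullet> b = K * (h \<bullet> b) - of_int \<lfloor>K * (h \<bullet> b)\<rfloor>"
              by (simp add: d_def inner_diff_left)
            then show "\<bar>(K *\<^sub>R h - d) \<bullet> b\<bar> \<le> 1" by linarith
          qed
          finally show ?thesis by (simp add: N_def)
        qed
        have "norm d \<le> norm (K *\<^sub>R h) + norm (d - K *\<^sub>R h)" by (rule norm_triangle_sub)
        then have "d \<in> S" using dist K1 Kp dlat by (simp add: S_def norm_minus_commute)
        from K0[OF kK this] have q: "\<bar>diff_quot f d k x - l \<bullet> d\<bar> < 1" .
        define s where "s = (1 / K) *\<^sub>R d"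
        have hs: "norm (h - s) \<le> N / K"
        proof -
          have "h - s = (1 / K) *\<^sub>R (K *\<^sub>R h - d)"
            using Kp by (simp add: s_def scaleR_diff_right)
          then show ?thesis using dist Kp by (simp add: divide_right_mono)
        qed
        have t1: "\<bar>f (x + h) - f (x + s)\<bar> \<le> L * (N / K)"
        proof -
          have "\<bar>f (x + h) - f (x + s)\<bar> \<le> L * norm (h - s)"
            using lipschitz_onD[OF f, of "x + h" "x + s"] by (simp add: dist_norm)
          then show ?thesis using mult_left_mono[OF hs L0] by linarith
        qed
        have t2: "\<bar>l \<bullet> (s - h)\<bar> \<le> norm l * (N / K)"
        proof -
          have "\<bar>l \<bullet> (s - h)\<bar> \<le> norm l * norm (s - h)" by (rule Cauchy_Schwarz_ineq2)
          then show ?thesis using mult_left_mono[OF hs norm_ge_zero[of l]] by (simp add: norm_minus_commute)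
        qed
        have t3: "\<bar>f (x + s) - f x - l \<bullet> s\<bar> \<le> 1 / K"
        proof -
          have "f (x + s) - f x - l \<bullet> s = (diff_quot f d k x - l \<bullet> d) / K"
            unfolding diff_quot_def s_def K_def[symmetric] using Kp by (simp add: diff_divide_distrib)
          then show ?thesis using q Kp by (simp add: divide_right_mono)
        qed
        have "f (x + h) - f x - l \<bullet> h = (f (x + h) - f (x + s)) + l \<bullet> (s - h) + (f (x + s) - f x - l \<bullet> s)"
          by (simp add: inner_diff_right)
        then have "\<bar>f (x + h) - f x - l \<bullet> h\<bar> \<le> L * (N / K) + norm l * (N / K) + 1 / K"
          using t1 t2 t3 by linarith
        also have "\<dots> = C / K" by (simp add: C_def add_divide_distrib distrib_right)
        also have "\<dots> \<le> e * norm h"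
          using K1(1) Kp e by (simp add: m_def field_simps)
        finally show ?thesis .
      qed simp
      show "\<exists>d>0. \<forall>y. norm (y - x) < d \<longrightarrow> norm (f y - f x - l \<bullet> (y - x)) \<le> e * norm (y - x)"
        by (rule exI[of _ \<delta>]) (use \<delta> main in \<open>force simp: algebra_simps\<close>)
    qed
    then show ?case by (auto simp: differentiable_def)
  qed
qed

section \<open>Concave envelopes and second order expansions\<close>

text \<open>The hypothesis says that \<psi> is touched from below at every point by a paraboloid of
  fixed opening. The envelope is read off the convex hull of the hypograph: supporting hyperplanes
  bound it above by affine functions, and the paraboloids bound its second differences below.
  Together they make it differentiable with Lipschitz gradient, as \<open>lipschitz_gradient\<close>
  shows.\<close>

lemma concave_envelope:
  fixes \<psi> :: "'a::euclidean_space \<Rightarrow> real"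
  assumes semi: "\<And>z. \<exists>p. \<forall>h. \<psi> z + p \<bullet> h - c * (norm h)\<^sup>2 \<le> \<psi> (z + h)"
    and ub: "\<And>z. \<psi> z \<le> a0 + p0 \<bullet> z"
  obtains \<eta> q where "\<And>z. \<psi> z \<le> \<eta> z"
    and "\<And>a p z. (\<And>y. \<psi> y \<le> a + p \<bullet> y) \<Longrightarrow> \<eta> z \<le> a + p \<bullet> z"
    and "\<And>z h. \<eta> (z + h) \<le> \<eta> z + q z \<bullet> h"
    and "\<And>z h. \<eta> z + q z \<bullet> h - 2 * c * (norm h)\<^sup>2 \<le> \<eta> (z + h)"
proof -
  define H where "H = convex hull {(y, s). s \<le> \<psi> y}"
  define \<eta> where "\<eta> z = Sup {t. (z, t) \<in> H}" for z
  have convH: "convex H" by (simp add: H_def)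
  have maj: "t \<le> a + p \<bullet> z" if "\<And>y. \<psi> y \<le> a + p \<bullet> y" "(z, t) \<in> H" for a p z t
  proof -
    have "H \<subseteq> {x. (- p, 1) \<bullet> x \<le> a}"
      unfolding H_def
    proof (rule hull_minimal)
      show "{(y, s). s \<le> \<psi> y} \<subseteq> {x. (- p, 1) \<bullet> x \<le> a}"
        using order_trans[OF _ that(1)] by (auto simp: algebra_simps)
    qed (rule convex_halfspace_le)
    from subsetD[OF this that(2)] show ?thesis by simp
  qed
  have minimal: "H \<subseteq> T" if "{(y, s). s \<le> \<psi> y} \<subseteq> T" "convex T" for T
    unfolding H_def using that by (rule hull_minimal)
  have inH: "(z, \<psi> z) \<in> H" for z by (simp add: H_def hull_inc)
  have bdd: "bdd_above {t. (z, t) \<in> H}" for z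
    using maj[OF ub] by (intro bdd_aboveI[of _ "a0 + p0 \<bullet> z"]) auto
  have up: "t \<le> \<eta> z" if "(z, t) \<in> H" for z t
    unfolding \<eta>_def by (rule cSup_upper[OF _ bdd]) (use that in simp)
  have least: "\<eta> z \<le> r" if "\<And>t. (z, t) \<in> H \<Longrightarrow> t \<le> r" for z r
    unfolding \<eta>_def by (rule cSup_least) (use inH that in auto)
  have sup: "\<exists>q. \<forall>h. \<eta> (z + h) \<le> \<eta> z + q \<bullet> h" for z
  proof -
    \<comment> \<open>Points strictly below points of the hull: unlike \<open>H\<close>, this convex
      set never contains \<open>(z, \<eta> z)\<close>, so the two can be separated.\<close>
    define U where "U = {(y, s). \<exists>t>s. (y, t) \<in> H}"
    have convU: "convex U"
    proof (rule convexI)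
      fix x x' :: "'a \<times> real" and u v :: real
      assume x: "x \<in> U" "x' \<in> U" and uv: "0 \<le> u" "0 \<le> v" "u + v = 1"
      obtain y s t y' s' t' where *: "x = (y, s)" "x' = (y', s')" "s < t" "s' < t'" "(y, t) \<in> H" "(y', t') \<in> H"
        using x by (auto simp: U_def)
      have "u *\<^sub>R (y, t) + v *\<^sub>R (y', t') \<in> H"
        using convexD[OF convH *(5,6) uv] .
      moreover have "u * s + v * s' < u * t + v * t'"
        using *(3,4) uv by (smt (verit) mult_left_mono mult_strict_left_mono)
      ultimately show "u *\<^sub>R x + v *\<^sub>R x' \<in> U" by (auto simp: U_def *)
    qed
    have "(z, \<psi> z - 1) \<in> U" using inH[of z] by (auto simp: U_def intro!: exI[of _ "\<psi> z"])
    then have "U \<noteq> {}" by blast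
    moreover have "U \<inter> {(z, \<eta> z)} = {}" using up by (force simp: U_def)
    ultimately obtain a b where ab: "a \<noteq> 0" "\<forall>x\<in>U. a \<bullet> x \<le> b" "\<forall>x\<in>{(z, \<eta> z)}. a \<bullet> x \<ge> b"
      using separating_hyperplane_sets[OF convU, of "{(z, \<eta> z)}"] by auto
    obtain r \<sigma> where a: "a = (r, \<sigma>)" by (cases a)
    have sep: "r \<bullet> y + \<sigma> * s \<le> r \<bullet> z + \<sigma> * \<eta> z" if "(y, t) \<in> H" "s < t" for y s t
    proof -
      have "(y, s) \<in> U" using that by (auto simp: U_def)
      then show ?thesis using ab(2,3) by (force simp: a)
    qed
    have "\<sigma> * (\<psi> z - 1) \<le> \<sigma> * \<eta> z" using sep[OF inH, of "\<psi> z - 1" z] by simp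
    then have "\<sigma> * (\<eta> z - \<psi> z + 1) \<ge> 0" by (simp add: algebra_simps)
    moreover have "\<eta> z - \<psi> z + 1 > 0" using up[OF inH[of z]] by simp
    ultimately have s0: "\<sigma> \<ge> 0" by (simp add: zero_le_mult_iff)
    \<comment> \<open>A vertical hyperplane is impossible because \<open>U\<close> projects onto the
      whole space; the point \<open>z + r\<close> refutes it.\<close>
    have "\<sigma> \<noteq> 0"
    proof
      assume "\<sigma> = 0"
      with ab(1) have "r \<noteq> 0" by (simp add: a zero_prod_def)
      moreover have "r \<bullet> (z + r) \<le> r \<bullet> z" using sep[OF inH, of "\<psi> (z + r) - 1" "z + r"] \<open>\<sigma> = 0\<close> by simp
      ultimately show False by (simp add: inner_add_right not_le[symmetric] flip: inner_gt_zero_iff)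
    qed
    with s0 have sp: "\<sigma> > 0" by simp
    have "\<eta> (z + h) \<le> \<eta> z + ((- 1 / \<sigma>) *\<^sub>R r) \<bullet> h" for h
    proof (rule least)
      fix t assume t: "(z + h, t) \<in> H"
      have "s \<le> \<eta> z + ((- 1 / \<sigma>) *\<^sub>R r) \<bullet> h" if "s < t" for s
      proof -
        have "\<sigma> * s \<le> \<sigma> * \<eta> z - r \<bullet> h" using sep[OF t that] by (simp add: inner_add_right)
        then show ?thesis using sp by (simp add: field_simps)
      qed
      then show "t \<le> \<eta> z + ((- 1 / \<sigma>) *\<^sub>R r) \<bullet> h" by (rule dense_le)
    qed
    then show ?thesis by blast
  qed
  then obtain q where q: "\<And>z h. \<eta> (z + h) \<le> \<eta> z + q z \<bullet> h" by metis
  \<comment> \<open>The bound on second differences is a condition on hypograph points that is preserved under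
    convex combinations, so it passes to the hull.\<close>
  have second: "2 * \<eta> z - 2 * c * (norm h)\<^sup>2 \<le> \<eta> (z + h) + \<eta> (z - h)" for z h
  proof -
    let ?T = "{(z, t). \<exists>t1 t2. (z + h, t1) \<in> H \<and> (z - h, t2) \<in> H \<and> 2 * t - 2 * c * (norm h)\<^sup>2 \<le> t1 + t2}"
    have "H \<subseteq> ?T"
    proof (rule minimal)
      show "{(y, s). s \<le> \<psi> y} \<subseteq> ?T"
      proof clarify
        fix y s assume s: "s \<le> \<psi> y"
        obtain p where p: "\<And>h. \<psi> y + p \<bullet> h - c * (norm h)\<^sup>2 \<le> \<psi> (y + h)" using semi by blast
        have "2 * s - 2 * c * (norm h)\<^sup>2 \<le> \<psi> (y + h) + \<psi> (y - h)"
          using p[of h] p[of "- h"] s by simp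
        then show "\<exists>t1 t2. (y + h, t1) \<in> H \<and> (y - h, t2) \<in> H \<and> 2 * s - 2 * c * (norm h)\<^sup>2 \<le> t1 + t2"
          using inH by blast
      qed
      show "convex ?T"
      proof (rule convexI)
        fix x x' :: "'a \<times> real" and u v :: real
        assume x: "x \<in> ?T" "x' \<in> ?T" and uv: "0 \<le> u" "0 \<le> v" "u + v = 1"
        obtain y s t1 t2 y' s' t1' t2' where *: "x = (y, s)" "x' = (y', s')"
          "(y + h, t1) \<in> H" "(y - h, t2) \<in> H" "2 * s - 2 * c * (norm h)\<^sup>2 \<le> t1 + t2"
          "(y' + h, t1') \<in> H" "(y' - h, t2') \<in> H" "2 * s' - 2 * c * (norm h)\<^sup>2 \<le> t1' + t2'"
          using x by auto
        have v: "v = 1 - u" using uv by simp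
        have "(u *\<^sub>R y + v *\<^sub>R y' + h, u * t1 + v * t1') \<in> H"
          using convexD[OF convH *(3,6) uv] by (simp add: v algebra_simps)
        moreover have "(u *\<^sub>R y + v *\<^sub>R y' - h, u * t2 + v * t2') \<in> H"
          using convexD[OF convH *(4,7) uv] by (simp add: v algebra_simps)
        moreover have "2 * (u * s + v * s') - 2 * c * (norm h)\<^sup>2 \<le> (u * t1 + v * t1') + (u * t2 + v * t2')"
          using mult_left_mono[OF *(5) uv(1)] mult_left_mono[OF *(8) uv(2)]
          by (simp add: v algebra_simps)
        ultimately show "u *\<^sub>R x + v *\<^sub>R x' \<in> ?T" by (auto simp: *)
      qed
    qed
    have "\<eta> z \<le> (\<eta> (z + h) + \<eta> (z - h) + 2 * c * (norm h)\<^sup>2) / 2"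
    proof (rule least)
      fix t assume "(z, t) \<in> H"
      with \<open>H \<subseteq> ?T\<close> obtain t1 t2 where "(z + h, t1) \<in> H" "(z - h, t2) \<in> H"
        "2 * t - 2 * c * (norm h)\<^sup>2 \<le> t1 + t2" by blast
      from this(3) up[OF this(1)] up[OF this(2)]
      show "t \<le> (\<eta> (z + h) + \<eta> (z - h) + 2 * c * (norm h)\<^sup>2) / 2" by simp
    qed
    then show ?thesis by (simp add: field_simps)
  qed
  show ?thesis
  proof (rule that[of \<eta> q])
    show "\<psi> z \<le> \<eta> z" for z using up[OF inH] .
    show "\<eta> z \<le> a + p \<bullet> z" if "\<And>y. \<psi> y \<le> a + p \<bullet> y" for a p z
      by (rule least) (use maj[OF that] in blast)
    show "\<eta> (z + h) \<le> \<eta> z + q z \<bullet> h" for z h by (rule q)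
    \<comment> \<open>The second difference bounds the sum of the values at \<open>z + h\<close> and
      \<open>z - h\<close> from below, and the affine upper bound at \<open>- h\<close> eliminates
      the latter; this is why the constant is 2 c.\<close>
    show "\<eta> z + q z \<bullet> h - 2 * c * (norm h)\<^sup>2 \<le> \<eta> (z + h)" for z h
      using second[of z h] q[of z "- h"] by simp
  qed
qed

text \<open>Take \<open>h\<close> in the direction of \<open>q y - q x\<close> with length
  \<open>norm (y - x)\<close> and compare the expansion of \<open>w (y + h)\<close> from
  \<open>y\<close> with those of \<open>w (y + h)\<close> and \<open>w y\<close> from
  \<open>x\<close>. The increments have lengths at most 1, 2 and 1 times
  \<open>norm (y - x)\<close>, whence 6 = 1 + 4 + 1.\<close>

lemma lipschitz_gradient:
  fixes w :: "'a::euclidean_space \<Rightarrow> real"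
  assumes w: "\<And>z h. \<bar>w (z + h) - w z - q z \<bullet> h\<bar> \<le> c * (norm h)\<^sup>2"
  shows "(6 * c)-lipschitz_on UNIV q"
proof (rule lipschitz_onI)
  obtain b :: 'a where "b \<in> Basis" using nonempty_Basis by blast
  then show "0 \<le> 6 * c" using order_trans[OF abs_ge_zero w[of 0 b]] by simp
  fix y x :: 'a
  define u where "u = q y - q x"
  define d where "d = norm (y - x)"
  show "dist (q y) (q x) \<le> 6 * c * dist y x"
  proof (cases "u = 0 \<or> d = 0")
    case False
    then have u: "norm u > 0" and d: "d > 0" by (auto simp: d_def)
    define h where "h = (d / norm u) *\<^sub>R u"
    have nh: "norm h = d" using u d by (simp add: h_def)
    have uh: "u \<bullet> h = d * norm u" using u by (simp add: h_def dot_square_norm power2_eq_square)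
    have "norm (y - x + h) \<le> 2 * d" using norm_triangle_ineq[of "y - x" h] nh by (simp add: d_def)
    then have "(norm (y - x + h))\<^sup>2 \<le> (2 * d)\<^sup>2" by (intro power_mono) auto
    then have 1: "c * (norm (y - x + h))\<^sup>2 \<le> 4 * c * d\<^sup>2"
      using \<open>0 \<le> 6 * c\<close> mult_left_mono[of "(norm (y - x + h))\<^sup>2" "(2 * d)\<^sup>2" c] by (simp add: power_mult_distrib)
    have e: "x + (y - x + h) = y + h" "x + (y - x) = y" by simp_all
    have "\<bar>w (y + h) - w y - q y \<bullet> h\<bar> \<le> c * d\<^sup>2" using w[of y h] by (simp add: nh)
    moreover have "\<bar>w (y + h) - w x - q x \<bullet> (y - x + h)\<bar> \<le> 4 * c * d\<^sup>2"
      using w[of x "y - x + h"] 1 unfolding e by linarith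
    moreover have "\<bar>w y - w x - q x \<bullet> (y - x)\<bar> \<le> c * d\<^sup>2"
      using w[of x "y - x"] unfolding e by (simp add: d_def)
    ultimately have "u \<bullet> h \<le> 6 * c * d\<^sup>2"
      unfolding u_def inner_diff_left inner_add_right by linarith
    then have "d * norm u \<le> d * (6 * c * d)" by (simp add: uh power2_eq_square mult_ac)
    then show ?thesis using d by (simp add: u_def d_def dist_norm)
  qed (use \<open>0 \<le> 6 * c\<close> in \<open>auto simp: u_def d_def dist_norm\<close>)
qed

text \<open>Along the segment from \<open>z\<close> to \<open>z + h\<close> the remainder has as
  derivative the first order remainder of \<open>q\<close> paired with \<open>h\<close>, and the
  mean value theorem finishes. Only the quadratic form of \<open>M\<close> is recorded.\<close>

lemma second_order_expansion:
  fixes w :: "'a::euclidean_space \<Rightarrow> real"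
  assumes w: "\<And>z h. \<bar>w (z + h) - w z - q z \<bullet> h\<bar> \<le> c * (norm h)\<^sup>2"
    and M: "(q has_derivative M) (at z)" and \<tau>: "0 < \<tau>"
  shows "\<exists>r>0. \<forall>h. norm h < r \<longrightarrow> \<bar>w (z + h) - w z - q z \<bullet> h - h \<bullet> M h / 2\<bar> \<le> \<tau> * (norm h)\<^sup>2"
proof -
  have dw: "(w has_derivative (\<lambda>h. q x \<bullet> h)) (at x)" for x
    unfolding has_derivative_at_alt
  proof (intro conjI allI impI)
    fix e :: real assume e: "0 < e"
    have c: "0 \<le> \<bar>c\<bar> + 1" by simp
    show "\<exists>d>0. \<forall>y. norm (y - x) < d \<longrightarrow> norm (w y - w x - q x \<bullet> (y - x)) \<le> e * norm (y - x)"
    proof (rule exI[of _ "e / (\<bar>c\<bar> + 1)"], intro conjI allI impI)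
      fix y assume y: "norm (y - x) < e / (\<bar>c\<bar> + 1)"
      have "\<bar>w y - w x - q x \<bullet> (y - x)\<bar> \<le> c * (norm (y - x))\<^sup>2" using w[of x "y - x"] by simp
      also have "\<dots> \<le> ((\<bar>c\<bar> + 1) * norm (y - x)) * norm (y - x)"
        unfolding power2_eq_square mult.assoc by (intro mult_right_mono) auto
      also have "\<dots> \<le> e * norm (y - x)"
        using y by (intro mult_right_mono) (auto simp: field_simps)
      finally show "norm (w y - w x - q x \<bullet> (y - x)) \<le> e * norm (y - x)" by simp
    qed (use e in auto)
  qed (rule bounded_linear_inner_right)
  have linM: "bounded_linear M" using M has_derivative_bounded_linear by blast
  obtain r where r: "r > 0" and rM: "\<And>y. norm (y - z) < r \<Longrightarrow> norm (q y - q z - M (y - z)) \<le> \<tau> * norm (y - z)"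
    using M \<tau> unfolding has_derivative_at_alt by blast
  have "\<bar>w (z + h) - w z - q z \<bullet> h - h \<bullet> M h / 2\<bar> \<le> \<tau> * (norm h)\<^sup>2" if h: "norm h < r" for h
  proof -
    define \<phi> where "\<phi> t = w (z + t *\<^sub>R h) - t * (q z \<bullet> h) - t\<^sup>2 / 2 * (h \<bullet> M h)" for t
    define \<phi>' where "\<phi>' t = q (z + t *\<^sub>R h) \<bullet> h - q z \<bullet> h - t * (h \<bullet> M h)" for t
    have "(\<phi> has_real_derivative \<phi>' t) (at t)" for t
    proof -
      have "((\<lambda>t. w (z + t *\<^sub>R h)) has_derivative (\<lambda>s. q (z + t *\<^sub>R h) \<bullet> (s *\<^sub>R h))) (at t)"
        by (rule has_derivative_compose[OF _ dw]) (auto intro!: derivative_eq_intros)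
      then have "((\<lambda>t. w (z + t *\<^sub>R h)) has_real_derivative (q (z + t *\<^sub>R h) \<bullet> h)) (at t)"
        by (simp add: has_field_derivative_def mult.commute[of _ "q (z + t *\<^sub>R h) \<bullet> h"])
      then show ?thesis
        unfolding \<phi>_def \<phi>'_def by (auto intro!: derivative_eq_intros)
    qed
    from MVT2[of 0 1 \<phi> \<phi>', OF _ this] obtain t where t: "0 < t" "t < 1" "\<phi> 1 - \<phi> 0 = \<phi>' t" by auto
    have "\<phi>' t = h \<bullet> (q (z + t *\<^sub>R h) - q z - M (t *\<^sub>R h))"
      by (simp add: \<phi>'_def inner_diff_right linear_simps(5)[OF linM] inner_commute)
    then have "\<bar>\<phi>' t\<bar> \<le> norm h * norm (q (z + t *\<^sub>R h) - q z - M (t *\<^sub>R h))"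
      using Cauchy_Schwarz_ineq2 by simp
    also have "\<dots> \<le> norm h * (\<tau> * norm (t *\<^sub>R h))"
    proof (rule mult_left_mono)
      have "norm (t *\<^sub>R h) \<le> norm h" using t by (simp add: mult_left_le_one_le)
      then show "norm (q (z + t *\<^sub>R h) - q z - M (t *\<^sub>R h)) \<le> \<tau> * norm (t *\<^sub>R h)"
        using rM[of "z + t *\<^sub>R h"] h by simp
    qed simp
    also have "\<dots> \<le> norm h * (\<tau> * norm h)"
      using t \<tau> by (intro mult_left_mono) (auto simp: mult_left_le_one_le)
    finally show ?thesis using t(3) by (simp add: \<phi>_def power2_eq_square mult_ac algebra_simps)
  qed
  with r show ?thesis by blast
qed

text \<open>The Lipschitz map \<open>q\<close> sends null sets to null sets, so a set mapped onto a
  ball cannot lie inside the null set where some component of \<open>q\<close> fails to be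
  differentiable. This is an argument about inclusion in a null set and requires no measurability of
  \<open>S\<close>.\<close>

lemma exists_second_order_expansion:
  fixes w :: "'a::euclidean_space \<Rightarrow> real"
  assumes w: "\<And>z h. \<bar>w (z + h) - w z - q z \<bullet> h\<bar> \<le> c * (norm h)\<^sup>2"
    and \<delta>: "0 < \<delta>" and S: "ball 0 \<delta> \<subseteq> q ` S"
  obtains z M where "z \<in> S" "linear M"
    "\<And>\<tau>. 0 < \<tau> \<Longrightarrow> \<exists>r>0. \<forall>h. norm h < r \<longrightarrow> \<bar>w (z + h) - w z - q z \<bullet> h - h \<bullet> M h / 2\<bar> \<le> \<tau> * (norm h)\<^sup>2"
proof -
  have q: "(6 * c)-lipschitz_on UNIV q" by (rule lipschitz_gradient[OF w])
  have "AE x in lborel. (\<lambda>x. q x \<bullet> b) differentiable (at x)" if b: "b \<in> Basis" for b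
  proof (rule lipschitz_AE_differentiable)
    show "(6 * c)-lipschitz_on UNIV (\<lambda>x. q x \<bullet> b)"
    proof (rule lipschitz_onI)
      fix x y :: 'a
      have "\<bar>(q x - q y) \<bullet> b\<bar> \<le> norm (q x - q y)" using b by (rule Basis_le_norm)
      then show "dist (q x \<bullet> b) (q y \<bullet> b) \<le> 6 * c * dist x y"
        using lipschitz_onD[OF q, of x y] by (simp add: dist_norm inner_diff_left)
    qed (rule lipschitz_on_nonneg[OF q])
  qed
  then have "AE x in lborel. \<forall>b\<in>Basis. (\<lambda>x. q x \<bullet> b) differentiable (at x)"
    by (subst AE_ball_countable) (auto intro: countable_finite)
  then obtain N where N: "{x. \<not> (\<forall>b\<in>Basis. (\<lambda>x. q x \<bullet> b) differentiable (at x))} \<subseteq> N"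
    and "N \<in> null_sets lborel"
    by (auto simp: eventually_ae_filter)
  then have negN: "negligible N"
    by (simp add: negligible_iff_null_sets null_sets_completionI)
  have "\<not> S \<subseteq> N"
  proof
    assume "S \<subseteq> N"
    with negN have "negligible S" by (rule negligible_subset)
    then have "negligible (q ` S)"
    proof (rule negligible_locally_Lipschitz_image[rotated])
      fix x assume "x \<in> S"
      show "\<exists>T B. open T \<and> x \<in> T \<and> (\<forall>y\<in>S \<inter> T. norm (q y - q x) \<le> B * norm (y - x))"
        by (rule exI[of _ UNIV]) (use lipschitz_onD[OF q] in \<open>auto simp: dist_norm\<close>)
    qed simp
    then have "negligible (ball (0::'a) \<delta>)" using S by (rule negligible_subset)
    moreover have "ball (0::'a) \<delta> \<noteq> {}" using \<delta> by simp
    ultimately show False using open_not_negligible[OF open_ball] by blast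
  qed
  then obtain z where z: "z \<in> S" "z \<notin> N" by blast
  then have "q differentiable (at z)"
    using N by (subst differentiable_componentwise_within) auto
  then obtain M where M: "(q has_derivative M) (at z)" by (auto simp: differentiable_def)
  show ?thesis
    by (rule that[OF z(1) has_derivative_linear[OF M]]) (rule second_order_expansion[OF w M])
qed

section \<open>Sup-convolutions and coupled jets\<close>

lemma usc_on_ball:
  fixes v :: "'a::metric_space \<Rightarrow> real"
  assumes "usc_on C v" "x \<in> C" "v x < c"
  shows "\<exists>d>0. \<forall>y\<in>C. dist y x < d \<longrightarrow> v y < c"
proof -
  have "\<forall>\<^sub>F y in at x within C. v y < c" using assms by (simp add: usc_on_def)
  then obtain d where "d > 0" "\<forall>y\<in>C. y \<noteq> x \<and> dist y x < d \<longrightarrow> v y < c"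
    unfolding eventually_at by blast
  with assms(3) show ?thesis by metis
qed

text \<open>If every \<open>x\<close> had a better point \<open>g x\<close>, then \<open>v\<close>
  would stay below \<open>v (g x)\<close> near \<open>x\<close>. In a finite subcover by such
  neighbourhoods, the best of the points \<open>g x\<close> lies in one of them and would be
  strictly worse than itself.\<close>

lemma usc_on_attains_sup:
  fixes v :: "'a::metric_space \<Rightarrow> real"
  assumes v: "usc_on C v" and C: "compact C" "C \<noteq> {}"
  shows "\<exists>x\<in>C. \<forall>y\<in>C. v y \<le> v x"
proof (rule ccontr)
  assume "\<not> ?thesis"
  then have "\<forall>x\<in>C. \<exists>y\<in>C. v x < v y" by (meson not_le)
  then obtain g where g: "\<And>x. x \<in> C \<Longrightarrow> g x \<in> C \<and> v x < v (g x)" by metis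
  have "\<exists>d>0. \<forall>y\<in>C. dist y x < d \<longrightarrow> v y < v (g x)" if "x \<in> C" for x
    using usc_on_ball[OF v that, of "v (g x)"] g[OF that] by blast
  then obtain d where d: "\<And>x. x \<in> C \<Longrightarrow> d x > 0"
    "\<And>x y. x \<in> C \<Longrightarrow> y \<in> C \<Longrightarrow> dist y x < d x \<Longrightarrow> v y < v (g x)" by metis
  have "C \<subseteq> (\<Union>x\<in>C. ball x (d x))" using d(1) by force
  then obtain D where D: "D \<subseteq> C" "finite D" "C \<subseteq> (\<Union>x\<in>D. ball x (d x))"
    using compactE_image[OF C(1), of C "\<lambda>x. ball x (d x)"] open_ball by blast
  with C(2) have D0: "D \<noteq> {}" by auto
  define m where "m = Max ((\<lambda>x. v (g x)) ` D)"
  have "m \<in> (\<lambda>x. v (g x)) ` D" unfolding m_def using D D0 by (intro Max_in) auto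
  then obtain x where x: "x \<in> D" "m = v (g x)" by blast
  have "g x \<in> C" using x D g by blast
  then obtain x' where x': "x' \<in> D" "dist (g x) x' < d x'"
    using D(3) by (auto simp: dist_commute)
  have "m < v (g x')" using d(2)[OF _ \<open>g x \<in> C\<close> x'(2)] x' D x(2) by auto
  moreover have "v (g x') \<le> m" unfolding m_def using D x'(1) by (intro Max_ge) auto
  ultimately show False by simp
qed

lemma usc_on_add_continuous:
  assumes v: "usc_on C v" and g: "continuous_on C g"
  shows "usc_on C (\<lambda>x. v x + g x)"
  unfolding usc_on_def
proof (intro ballI allI impI)
  fix x c assume x: "x \<in> C" and less: "v x + g x < c"
  define e where "e = (c - v x - g x) / 2"
  have e: "e > 0" using less by (simp add: e_def)
  have "\<forall>\<^sub>F y in at x within C. v y < v x + e" using v x e by (auto simp: usc_on_def)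
  moreover have "\<forall>\<^sub>F y in at x within C. g y < g x + e"
    using order_tendstoD(2)[of g "g x" "at x within C" "g x + e"] g x e by (auto simp: continuous_on_def)
  ultimately show "\<forall>\<^sub>F y in at x within C. v y + g y < c"
    by eventually_elim (auto simp: e_def field_simps)
qed

text \<open>The maximiser is kept as a function \<xi>, because a jet of \<open>a\<close> at
  \<open>x\<close> becomes a jet of \<open>v\<close> at \<open>\<xi> x\<close>.\<close>

lemma sup_convolution:
  fixes v :: "'a::euclidean_space \<Rightarrow> real"
  assumes v: "usc_on C v" and C: "compact C" "C \<noteq> {}"
  obtains a \<xi> where "\<And>x y. y \<in> C \<Longrightarrow> v y - \<alpha> / 2 * (norm (x - y))\<^sup>2 \<le> a x"
    and "\<And>x. \<xi> x \<in> C" "\<And>x. a x = v (\<xi> x) - \<alpha> / 2 * (norm (x - \<xi> x))\<^sup>2"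
proof -
  have "\<exists>\<xi>\<in>C. \<forall>y\<in>C. v y - \<alpha> / 2 * (norm (x - y))\<^sup>2 \<le> v \<xi> - \<alpha> / 2 * (norm (x - \<xi>))\<^sup>2" for x
  proof -
    have "usc_on C (\<lambda>y. v y + - (\<alpha> / 2 * (norm (x - y))\<^sup>2))"
      by (rule usc_on_add_continuous[OF v]) (intro continuous_intros)
    from usc_on_attains_sup[OF this C] show ?thesis by simp
  qed
  then obtain \<xi> where "\<And>x. \<xi> x \<in> C"
    "\<And>x y. y \<in> C \<Longrightarrow> v y - \<alpha> / 2 * (norm (x - y))\<^sup>2 \<le> v (\<xi> x) - \<alpha> / 2 * (norm (x - \<xi> x))\<^sup>2"
    by metis
  then show ?thesis
    by (intro that[of "\<lambda>x. v (\<xi> x) - \<alpha> / 2 * (norm (x - \<xi> x))\<^sup>2" \<xi>]) auto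
qed

lemma norm_add_square: "(norm (x + y))\<^sup>2 = (norm x)\<^sup>2 + 2 * (x \<bullet> y) + (norm (y::'a::real_inner))\<^sup>2"
  by (simp add: power2_norm_eq_inner inner_add_left inner_add_right inner_commute)

lemma norm_diff_square: "(norm (x - y))\<^sup>2 = (norm x)\<^sup>2 - 2 * (x \<bullet> y) + (norm (y::'a::real_inner))\<^sup>2"
  by (simp add: power2_norm_eq_inner inner_diff_left inner_diff_right inner_commute)

text \<open>Adding \<open>c * (norm z)\<^sup>2\<close> turns the paraboloids into supporting affine
  functions; the sum is convex and finite on the whole space, hence continuous.\<close>

lemma semiconvex_continuous_on:
  fixes \<psi> :: "'a::euclidean_space \<Rightarrow> real"
  assumes semi: "\<And>z. \<exists>p. \<forall>h. \<psi> z + p \<bullet> h - c * (norm h)\<^sup>2 \<le> \<psi> (z + h)"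
  shows "continuous_on UNIV \<psi>"
proof -
  define \<phi> where "\<phi> z = \<psi> z + c * (norm z)\<^sup>2" for z
  have sup: "\<exists>p. \<forall>y. \<phi> z + p \<bullet> (y - z) \<le> \<phi> y" for z
  proof -
    obtain p where p: "\<And>h. \<psi> z + p \<bullet> h - c * (norm h)\<^sup>2 \<le> \<psi> (z + h)" using semi by blast
    have "\<phi> z + (p + (2 * c) *\<^sub>R z) \<bullet> (y - z) \<le> \<phi> y" for y
    proof -
      have "(norm (y - z))\<^sup>2 = (norm y)\<^sup>2 - (norm z)\<^sup>2 - 2 * (z \<bullet> (y - z))"
        by (simp add: norm_diff_square inner_diff_right inner_commute power2_norm_eq_inner)
      then have "c * (norm (y - z))\<^sup>2 = c * (norm y)\<^sup>2 - c * (norm z)\<^sup>2 - 2 * c * (z \<bullet> (y - z))"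
        by (simp only: right_diff_distrib)
      then show ?thesis using p[of "y - z"] by (simp add: \<phi>_def inner_add_left)
    qed
    then show ?thesis by blast
  qed
  have "convex_on UNIV \<phi>"
  proof (rule convex_onI)
    fix t :: real and x y :: 'a assume t: "0 < t" "t < 1"
    define z where "z = (1 - t) *\<^sub>R x + t *\<^sub>R y"
    obtain p where p: "\<And>y. \<phi> z + p \<bullet> (y - z) \<le> \<phi> y" using sup by blast
    have "(1 - t) * (\<phi> z + p \<bullet> (x - z)) + t * (\<phi> z + p \<bullet> (y - z)) \<le> (1 - t) * \<phi> x + t * \<phi> y"
      using t by (intro add_mono mult_left_mono p) auto
    moreover have "(1 - t) * (p \<bullet> (x - z)) + t * (p \<bullet> (y - z)) = 0"
      by (simp add: z_def inner_diff_right inner_add_right algebra_simps)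
    ultimately show "\<phi> ((1 - t) *\<^sub>R x + t *\<^sub>R y) \<le> (1 - t) * \<phi> x + t * \<phi> y"
      unfolding z_def[symmetric] by (simp add: algebra_simps)
  qed auto
  then have "continuous_on UNIV (\<lambda>z. \<phi> z - c * (norm z)\<^sup>2)"
    by (intro continuous_intros convex_on_continuous) auto
  then show ?thesis by (simp add: \<phi>_def)
qed

lemma eq_zero_if_inner_le_square:
  fixes u :: "'a::real_inner"
  assumes "\<And>h. u \<bullet> h \<le> C * (norm h)\<^sup>2"
  shows "u = 0"
proof (rule ccontr)
  assume u: "u \<noteq> 0"
  define t where "t = 1 / (\<bar>C\<bar> + 1)"
  have t: "t > 0" "C * t < 1" by (simp_all add: t_def field_simps)
  have "t * (norm u)\<^sup>2 \<le> C * (t * norm u)\<^sup>2"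
    using assms[of "t *\<^sub>R u"] t by (simp add: dot_square_norm)
  also have "\<dots> = (C * t) * (t * (norm u)\<^sup>2)" by (simp add: power2_eq_square)
  also have "\<dots> < 1 * (t * (norm u)\<^sup>2)" using t u by (intro mult_strict_right_mono) auto
  finally show False by simp
qed

lemma coercive_attains_sup:
  fixes W :: "'a::euclidean_space \<Rightarrow> real"
  assumes cont: "continuous_on UNIV W" and \<kappa>: "0 < \<kappa>"
    and le: "\<And>z. W z \<le> m - \<kappa> / 2 * (norm z)\<^sup>2"
  obtains z where "\<And>z'. W z' - P \<bullet> z' \<le> W z - P \<bullet> z"
proof -
  \<comment> \<open>Outside this ball the quadratic term outweighs both the linear term and the gap
    between \<open>m\<close> and \<open>W 0\<close>, so no value there exceeds the one at 0. The
    summand 1 gives \<open>norm z' \<ge> 1\<close>, which lets the constant gap be absorbed into a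
    multiple of the norm.\<close>
  define R where "R = 2 / \<kappa> * (norm P + \<bar>m - W 0\<bar>) + 1"
  have R: "R \<ge> 1" using \<kappa> by (simp add: R_def)
  have "continuous_on (cball 0 R) (\<lambda>z. W z - P \<bullet> z)"
    by (intro continuous_intros continuous_on_subset[OF cont]) auto
  moreover have "cball (0::'a) R \<noteq> {}" using R by simp
  ultimately obtain z where z: "\<And>z'. z' \<in> cball 0 R \<Longrightarrow> W z' - P \<bullet> z' \<le> W z - P \<bullet> z"
    using continuous_attains_sup[OF compact_cball] by blast
  have "W z' - P \<bullet> z' \<le> W z - P \<bullet> z" if "z' \<notin> cball 0 R" for z'
  proof -
    have n: "norm z' > R" using that by simp
    then have n1: "norm z' \<ge> 1" using R by simp
    have "norm P + \<bar>m - W 0\<bar> \<le> \<kappa> / 2 * norm z'" using n \<kappa> by (simp add: R_def field_simps)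
    then have "(norm P + \<bar>m - W 0\<bar>) * norm z' \<le> (\<kappa> / 2 * norm z') * norm z'"
      by (rule mult_right_mono) simp
    moreover have "\<bar>m - W 0\<bar> * 1 \<le> \<bar>m - W 0\<bar> * norm z'" using n1 by (intro mult_left_mono) auto
    ultimately have "norm P * norm z' + \<bar>m - W 0\<bar> \<le> \<kappa> / 2 * (norm z')\<^sup>2"
      by (simp add: power2_eq_square algebra_simps)
    moreover have "- (P \<bullet> z') \<le> norm P * norm z'" using Cauchy_Schwarz_ineq2[of P z'] by linarith
    ultimately have "W z' - P \<bullet> z' \<le> W 0 - P \<bullet> 0" using le[of z'] by (simp add: abs_if split: if_splits)
    also have "\<dots> \<le> W z - P \<bullet> z" using R by (intro z) auto
    finally show ?thesis .
  qed
  with z that show ?thesis by blast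
qed

text \<open>The maximiser at \<open>z\<close> is still a competitor at \<open>z + h\<close>; its
  paraboloid has opening \<alpha> / 2 and touches \<open>a\<close> from below at \<open>z\<close>.
  Subtracting the quadratic term enlarges the opening by \<beta>.\<close>

lemma sup_convolution_semiconvex:
  fixes a :: "'a::euclidean_space \<Rightarrow> real"
  assumes "\<And>x y. y \<in> C \<Longrightarrow> v y - \<alpha> / 2 * (norm (x - y))\<^sup>2 \<le> a x"
    and "\<And>x. \<xi> x \<in> C" "\<And>x. a x = v (\<xi> x) - \<alpha> / 2 * (norm (x - \<xi> x))\<^sup>2"
  shows "\<exists>p. \<forall>h. a z - \<beta> * (norm z)\<^sup>2 + p \<bullet> h - (\<alpha> / 2 + \<beta>) * (norm h)\<^sup>2 \<le> a (z + h) - \<beta> * (norm (z + h))\<^sup>2"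
proof (rule exI[of _ "- \<alpha> *\<^sub>R (z - \<xi> z) - (2 * \<beta>) *\<^sub>R z"], rule allI)
  fix h
  define u where "u = z - \<xi> z"
  have "z + h - \<xi> z = u + h" by (simp add: u_def)
  then have "\<alpha> / 2 * (norm (z + h - \<xi> z))\<^sup>2 = \<alpha> / 2 * (norm u)\<^sup>2 + \<alpha> * (u \<bullet> h) + \<alpha> / 2 * (norm h)\<^sup>2"
    by (simp only: norm_add_square) (simp add: algebra_simps)
  moreover have "\<beta> * (norm (z + h))\<^sup>2 = \<beta> * (norm z)\<^sup>2 + 2 * \<beta> * (z \<bullet> h) + \<beta> * (norm h)\<^sup>2"
    by (simp only: norm_add_square) (simp add: algebra_simps)
  moreover have "(- \<alpha> *\<^sub>R u - (2 * \<beta>) *\<^sub>R z) \<bullet> h = - (\<alpha> * (u \<bullet> h)) - 2 * \<beta> * (z \<bullet> h)"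
    by (simp add: inner_diff_left)
  ultimately show "a z - \<beta> * (norm z)\<^sup>2 + (- \<alpha> *\<^sub>R (z - \<xi> z) - (2 * \<beta>) *\<^sub>R z) \<bullet> h - (\<alpha> / 2 + \<beta>) * (norm h)\<^sup>2
      \<le> a (z + h) - \<beta> * (norm (z + h))\<^sup>2"
    using assms(1)[OF assms(2)[of z], of "z + h"] assms(3)[of z]
    unfolding u_def[symmetric] distrib_right by linarith
qed

lemma norm_Pair_square: "(norm (x, y))\<^sup>2 = (norm x)\<^sup>2 + (norm y)\<^sup>2"
  by (simp add: norm_Pair)

text \<open>A substitute for the Crandall--Ishii theorem on sums, stated with quadratic forms.  The
  functions \<open>a\<close> and \<open>b\<close> in the proof are sup-convolutions, and \<open>ha\<close>, \<open>hb\<close> are their concave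
  envelopes up to the paraboloid \<open>\<beta> |x|\<^sup>2\<close>; with this choice of \<open>\<beta>\<close> the only coupling left between
  the two variables is the bilinear term \<open>\<alpha> (x \<bullet> y)\<close>, so both envelopes can be taken one after
  the other without spoiling an affine majorant.\<close>

lemma coupled_jets:
  fixes v u :: "'a::euclidean_space \<Rightarrow> real"
  assumes v: "usc_on C v" and u: "usc_on C u" and C: "compact C" and x0: "x0 \<in> C"
    and \<alpha>: "0 < \<alpha>" and \<kappa>: "0 < \<kappa>"
  obtains x y \<xi> \<eta> p r X Y where "\<xi> \<in> C" "\<eta> \<in> C" "linear X" "linear Y"
    and "v x0 + u x0 - \<kappa> * (norm x0 + 1)\<^sup>2
      \<le> v \<xi> + u \<eta> - \<alpha> / 2 * ((norm (x - \<xi>))\<^sup>2 + (norm (y - \<eta>))\<^sup>2 + (norm (x - y))\<^sup>2)"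
    and "\<And>\<tau>. 0 < \<tau> \<Longrightarrow> \<exists>d>0. \<forall>h. norm h < d \<longrightarrow> \<xi> + h \<in> C \<longrightarrow>
      v (\<xi> + h) \<le> v \<xi> + p \<bullet> h + h \<bullet> X h / 2 + \<tau> * (norm h)\<^sup>2"
    and "\<And>\<tau>. 0 < \<tau> \<Longrightarrow> \<exists>d>0. \<forall>h. norm h < d \<longrightarrow> \<eta> + h \<in> C \<longrightarrow>
      u (\<eta> + h) \<le> u \<eta> + r \<bullet> h + h \<bullet> Y h / 2 + \<tau> * (norm h)\<^sup>2"
    and "\<And>h k. h \<bullet> X h + k \<bullet> Y k \<le> \<alpha> * (norm (h - k))\<^sup>2 + \<kappa> * ((norm h)\<^sup>2 + (norm k)\<^sup>2)"
proof -
  have C0: "C \<noteq> {}" using x0 by blast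
  obtain a \<xi> where a: "\<And>x y. y \<in> C \<Longrightarrow> v y - \<alpha> / 2 * (norm (x - y))\<^sup>2 \<le> a x"
    "\<And>x. \<xi> x \<in> C" "\<And>x. a x = v (\<xi> x) - \<alpha> / 2 * (norm (x - \<xi> x))\<^sup>2"
    by (rule sup_convolution[OF v C C0, of \<alpha>]) blast
  obtain b \<eta> where b: "\<And>x y. y \<in> C \<Longrightarrow> u y - \<alpha> / 2 * (norm (x - y))\<^sup>2 \<le> b x"
    "\<And>x. \<eta> x \<in> C" "\<And>x. b x = u (\<eta> x) - \<alpha> / 2 * (norm (x - \<eta> x))\<^sup>2"
    by (rule sup_convolution[OF u C C0, of \<alpha>]) blast
  obtain xv where xv: "\<forall>y\<in>C. v y \<le> v xv"
    using usc_on_attains_sup[OF v C C0] by blast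
  obtain xu where xu: "\<forall>y\<in>C. u y \<le> u xu"
    using usc_on_attains_sup[OF u C C0] by blast
  have a_le: "a x \<le> v xv" for x
  proof -
    have "0 \<le> \<alpha> / 2 * (norm (x - \<xi> x))\<^sup>2" using \<alpha> by simp
    then show ?thesis using bspec[OF xv a(2)[of x]] a(3)[of x] by linarith
  qed
  have b_le: "b x \<le> u xu" for x
  proof -
    have "0 \<le> \<alpha> / 2 * (norm (x - \<eta> x))\<^sup>2" using \<alpha> by simp
    then show ?thesis using bspec[OF xu b(2)[of x]] b(3)[of x] by linarith
  qed
  \<comment> \<open>Expanding the coupling \<alpha> / 2 |x - y|^2 together with the coercivity term
    \<kappa> / 2 (|x|^2 + |y|^2) leaves \<beta> |x|^2 + \<beta> |y|^2 and the bilinear term; see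
    \<open>W_alt\<close>.\<close>
  define \<beta> where "\<beta> = (\<alpha> + \<kappa>) / 2"
  have \<beta>: "\<beta> > 0" using \<alpha> \<kappa> by (simp add: \<beta>_def)
  define c where "c = \<alpha> / 2 + \<beta>"
  have c: "c > 0" using \<alpha> \<beta> by (simp add: c_def)
  define \<psi>a where "\<psi>a x = a x - \<beta> * (norm x)\<^sup>2" for x
  define \<psi>b where "\<psi>b x = b x - \<beta> * (norm x)\<^sup>2" for x
  have sa: "\<exists>p. \<forall>h. \<psi>a z + p \<bullet> h - c * (norm h)\<^sup>2 \<le> \<psi>a (z + h)" for z
    unfolding \<psi>a_def c_def by (rule sup_convolution_semiconvex[OF a])
  have sb: "\<exists>p. \<forall>h. \<psi>b z + p \<bullet> h - c * (norm h)\<^sup>2 \<le> \<psi>b (z + h)" for z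
    unfolding \<psi>b_def c_def by (rule sup_convolution_semiconvex[OF b])
  have ua: "\<psi>a z \<le> v xv + 0 \<bullet> z" for z
    using a_le[of z] mult_nonneg_nonneg[OF less_imp_le[OF \<beta>] zero_le_power2[of "norm z"]] unfolding \<psi>a_def by simp
  have ub: "\<psi>b z \<le> u xu + 0 \<bullet> z" for z
    using b_le[of z] mult_nonneg_nonneg[OF less_imp_le[OF \<beta>] zero_le_power2[of "norm z"]] unfolding \<psi>b_def by simp
  obtain ha qa where ha: "\<And>z. \<psi>a z \<le> ha z"
    and ha_least: "\<And>a p z. (\<And>y. \<psi>a y \<le> a + p \<bullet> y) \<Longrightarrow> ha z \<le> a + p \<bullet> z"
    and qa: "\<And>z h. ha (z + h) \<le> ha z + qa z \<bullet> h"
      "\<And>z h. ha z + qa z \<bullet> h - 2 * c * (norm h)\<^sup>2 \<le> ha (z + h)"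
    using concave_envelope[of \<psi>a c, OF sa ua] by metis
  obtain hb qb where hb: "\<And>z. \<psi>b z \<le> hb z"
    and hb_least: "\<And>a p z. (\<And>y. \<psi>b y \<le> a + p \<bullet> y) \<Longrightarrow> hb z \<le> a + p \<bullet> z"
    and qb: "\<And>z h. hb (z + h) \<le> hb z + qb z \<bullet> h"
      "\<And>z h. hb z + qb z \<bullet> h - 2 * c * (norm h)\<^sup>2 \<le> hb (z + h)"
    using concave_envelope[of \<psi>b c, OF sb ub] by metis
  define W where "W z = \<psi>a (fst z) + \<psi>b (snd z) + \<alpha> * (fst z \<bullet> snd z)" for z
  define w where "w z = ha (fst z) + hb (snd z) + \<alpha> * (fst z \<bullet> snd z)" for z
  define q where "q z = (qa (fst z) + \<alpha> *\<^sub>R snd z, qb (snd z) + \<alpha> *\<^sub>R fst z)" for z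
  have W_alt: "W z = a (fst z) + b (snd z) - \<alpha> / 2 * (norm (fst z - snd z))\<^sup>2 - \<kappa> / 2 * (norm z)\<^sup>2" for z
    by (cases z) (simp add: W_def \<psi>a_def \<psi>b_def \<beta>_def norm_Pair_square norm_diff_square algebra_simps add_divide_distrib)
  have Ww: "W z \<le> w z" for z using ha hb by (simp add: W_def w_def add_mono)
  \<comment> \<open>With one variable frozen the bilinear term is affine in the other, so the bound
    is an affine majorant of \<open>\<psi>a\<close> and passes to \<open>ha\<close>; then the roles
    are exchanged.\<close>
  have majorant: "w z \<le> m + P \<bullet> z" if "\<And>z. W z \<le> m + P \<bullet> z" for m P z
  proof -
    obtain P1 P2 where P: "P = (P1, P2)" by (cases P)
    have 1: "\<psi>a x + \<psi>b y + \<alpha> * (x \<bullet> y) \<le> m + P1 \<bullet> x + P2 \<bullet> y" for x y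
      using that[of "(x, y)"] by (simp add: W_def P)
    have 2: "ha x + \<psi>b y + \<alpha> * (x \<bullet> y) \<le> m + P1 \<bullet> x + P2 \<bullet> y" for x y
    proof -
      have "ha x \<le> (m + P2 \<bullet> y - \<psi>b y) + (P1 - \<alpha> *\<^sub>R y) \<bullet> x"
      proof (rule ha_least)
        show "\<psi>a x \<le> (m + P2 \<bullet> y - \<psi>b y) + (P1 - \<alpha> *\<^sub>R y) \<bullet> x" for x
          using 1[of x y] by (simp add: inner_diff_left inner_commute[of y x])
      qed
      then show ?thesis by (simp add: inner_diff_left inner_commute[of y x])
    qed
    have "hb y \<le> (m + P1 \<bullet> x - ha x) + (P2 - \<alpha> *\<^sub>R x) \<bullet> y" for x y
    proof (rule hb_least)
      show "\<psi>b y \<le> (m + P1 \<bullet> x - ha x) + (P2 - \<alpha> *\<^sub>R x) \<bullet> y" for y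
        using 2[of x y] by (simp add: inner_diff_left)
    qed
    from this[of "snd z" "fst z"] show ?thesis
      by (cases z) (simp add: w_def P inner_diff_left)
  qed
  have wq: "\<bar>w (z + h) - w z - q z \<bullet> h\<bar> \<le> (2 * c + \<alpha>) * (norm h)\<^sup>2" for z h
  proof -
    obtain x y where z: "z = (x, y)" by (cases z)
    obtain h1 h2 where h: "h = (h1, h2)" by (cases h)
    have "w (z + h) - w z - q z \<bullet> h
        = (ha (x + h1) - ha x - qa x \<bullet> h1) + (hb (y + h2) - hb y - qb y \<bullet> h2) + \<alpha> * (h1 \<bullet> h2)"
      by (simp add: w_def q_def z h inner_add_left inner_add_right inner_commute algebra_simps)
    moreover have "\<bar>ha (x + h1) - ha x - qa x \<bullet> h1\<bar> \<le> 2 * c * (norm h1)\<^sup>2"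
      using qa[of x h1] by linarith
    moreover have "\<bar>hb (y + h2) - hb y - qb y \<bullet> h2\<bar> \<le> 2 * c * (norm h2)\<^sup>2"
      using qb[of y h2] by linarith
    moreover have "\<bar>\<alpha> * (h1 \<bullet> h2)\<bar> \<le> \<alpha> * ((norm h1)\<^sup>2 + (norm h2)\<^sup>2)"
    proof -
      have "\<bar>h1 \<bullet> h2\<bar> \<le> norm h1 * norm h2" by (rule Cauchy_Schwarz_ineq2)
      also have "\<dots> \<le> (norm h1)\<^sup>2 + (norm h2)\<^sup>2"
        using sum_squares_bound[of "norm h1" "norm h2"] mult_nonneg_nonneg[OF norm_ge_zero[of h1] norm_ge_zero[of h2]]
        by linarith
      finally show ?thesis using \<alpha> by (simp add: abs_mult)
    qed
    ultimately show ?thesis by (simp add: h norm_Pair_square algebra_simps)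
  qed
  define contact where "contact P z \<longleftrightarrow> (\<forall>z'. W z' - P \<bullet> z' \<le> W z - P \<bullet> z)" for P z
  \<comment> \<open>The affine function touching \<open>W\<close> at \<open>z\<close> also majorises
    \<open>w\<close>. Since \<open>W \<le> w\<close>, both agree at \<open>z\<close>, and the
    gradient of \<open>w\<close> there can only be \<open>P\<close>.\<close>
  have contact_w: "w (z + h) \<le> W z + P \<bullet> h" if "contact P z" for P z h
  proof -
    have "w (z + h) \<le> (W z - P \<bullet> z) + P \<bullet> (z + h)"
    proof (rule majorant)
      show "W z' \<le> (W z - P \<bullet> z) + P \<bullet> z'" for z'
        using that unfolding contact_def by (smt (verit))
    qed
    then show ?thesis by (simp add: inner_add_right)
  qed
  have contact_eq: "w z = W z" if "contact P z" for P z
    using contact_w[OF that, of 0] Ww[of z] by simp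
  have contact_q: "q z = P" if "contact P z" for P z
  proof -
    have "(q z - P) \<bullet> h \<le> (2 * c + \<alpha>) * (norm h)\<^sup>2" for h
      using wq[of z h] contact_w[OF that, of h] contact_eq[OF that]
      by (simp add: inner_diff_left abs_le_iff)
    from eq_zero_if_inner_le_square[OF this] show ?thesis by simp
  qed
  define S where "S = {z. \<exists>P\<in>ball 0 \<kappa>. contact P z}"
  have cont: "continuous_on UNIV W"
    unfolding W_def
    by (intro continuous_intros continuous_on_compose2[OF semiconvex_continuous_on[of \<psi>a c, OF sa]]
        continuous_on_compose2[OF semiconvex_continuous_on[of \<psi>b c, OF sb]]) auto
  have coerc: "W z \<le> (v xv + u xu) - \<kappa> / 2 * (norm z)\<^sup>2" for z
  proof -
    have "0 \<le> \<alpha> / 2 * (norm (fst z - snd z))\<^sup>2" using \<alpha> by simp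
    then show ?thesis using a_le[of "fst z"] b_le[of "snd z"] unfolding W_alt by linarith
  qed
  have "ball 0 \<kappa> \<subseteq> q ` S"
  proof
    fix P :: "'a \<times> 'a" assume P: "P \<in> ball 0 \<kappa>"
    obtain z where "contact P z"
      using coercive_attains_sup[OF cont \<kappa> coerc, of P] unfolding contact_def by blast
    then have "z \<in> S" "P = q z" using contact_q P by (auto simp: S_def)
    then show "P \<in> q ` S" by blast
  qed
  from exists_second_order_expansion[of w q "2 * c + \<alpha>" \<kappa> S, OF wq \<kappa> this] obtain z M where zS: "z \<in> S" and M: "linear M"
    and exp: "\<And>\<tau>. 0 < \<tau> \<Longrightarrow> \<exists>r>0. \<forall>h. norm h < r \<longrightarrow> \<bar>w (z + h) - w z - q z \<bullet> h - h \<bullet> M h / 2\<bar> \<le> \<tau> * (norm h)\<^sup>2"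
    by blast
  obtain x y where z: "z = (x, y)" by (cases z)
  obtain P where P: "P \<in> ball 0 \<kappa>" and ct: "contact P z" using zS by (auto simp: S_def)
  obtain P1 P2 where P12: "P = (P1, P2)" by (cases P)
  \<comment> \<open>Equality of the sums, with each envelope at least its function, forces equality
    of both summands.\<close>
  have eqab: "ha x = \<psi>a x" "hb y = \<psi>b y"
    using contact_eq[OF ct] ha[of x] hb[of y] by (auto simp: w_def W_def z)
  \<comment> \<open>The diagonal blocks of \<open>M\<close>: along \<open>(h, 0)\<close> and
    \<open>(0, k)\<close> the bilinear term is linear, so the expansion of \<open>w\<close>
    restricts to one of each envelope and only the slope changes.\<close>
  define Ma where "Ma h = fst (M (h, 0))" for h
  define Mb where "Mb k = snd (M (0, k))" for k
  have linMa: "linear Ma"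
  proof (rule linearI)
    show "Ma (h + k) = Ma h + Ma k" for h k
      using linear_add[OF M, of "(h, 0)" "(k, 0)"] by (simp add: Ma_def)
    show "Ma (r *\<^sub>R h) = r *\<^sub>R Ma h" for r h
      using linear_scale[OF M, of r "(h, 0)"] by (simp add: Ma_def)
  qed
  have linMb: "linear Mb"
  proof (rule linearI)
    show "Mb (h + k) = Mb h + Mb k" for h k
      using linear_add[OF M, of "(0, h)" "(0, k)"] by (simp add: Mb_def)
    show "Mb (r *\<^sub>R h) = r *\<^sub>R Mb h" for r h
      using linear_scale[OF M, of r "(0, h)"] by (simp add: Mb_def)
  qed
  have expa: "\<exists>r>0. \<forall>h. norm h < r \<longrightarrow> \<bar>ha (x + h) - ha x - (P1 - \<alpha> *\<^sub>R y) \<bullet> h - h \<bullet> Ma h / 2\<bar> \<le> \<tau> * (norm h)\<^sup>2"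
    if \<tau>: "0 < \<tau>" for \<tau>
  proof -
    obtain d where d: "d > 0" "\<And>h. norm h < d \<Longrightarrow> \<bar>w (z + h) - w z - P \<bullet> h - h \<bullet> M h / 2\<bar> \<le> \<tau> * (norm h)\<^sup>2"
      using exp[OF \<tau>] unfolding contact_q[OF ct] by blast
    have "\<bar>ha (x + h) - ha x - (P1 - \<alpha> *\<^sub>R y) \<bullet> h - h \<bullet> Ma h / 2\<bar> \<le> \<tau> * (norm h)\<^sup>2" if "norm h < d" for h
      using d(2)[of "(h, 0)"] that
      by (simp add: w_def z P12 Ma_def norm_Pair_square norm_Pair1 inner_prod_def inner_diff_left inner_add_left inner_commute algebra_simps)
    with d(1) show ?thesis by blast
  qed
  have expb: "\<exists>r>0. \<forall>h. norm h < r \<longrightarrow> \<bar>hb (y + h) - hb y - (P2 - \<alpha> *\<^sub>R x) \<bullet> h - h \<bullet> Mb h / 2\<bar> \<le> \<tau> * (norm h)\<^sup>2"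
    if \<tau>: "0 < \<tau>" for \<tau>
  proof -
    obtain d where d: "d > 0" "\<And>h. norm h < d \<Longrightarrow> \<bar>w (z + h) - w z - P \<bullet> h - h \<bullet> M h / 2\<bar> \<le> \<tau> * (norm h)\<^sup>2"
      using exp[OF \<tau>] unfolding contact_q[OF ct] by blast
    have "\<bar>hb (y + h) - hb y - (P2 - \<alpha> *\<^sub>R x) \<bullet> h - h \<bullet> Mb h / 2\<bar> \<le> \<tau> * (norm h)\<^sup>2" if "norm h < d" for h
      using d(2)[of "(0, h)"] that
      by (simp add: w_def z P12 Mb_def norm_Pair_square norm_Pair2 inner_prod_def inner_diff_left inner_add_right algebra_simps)
    with d(1) show ?thesis by blast
  qed
  \<comment> \<open>Adding 2 \<beta> times the identity undoes the subtraction of \<beta>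
    |x|^2.\<close>
  define X where "X h = (\<alpha> + \<kappa>) *\<^sub>R h + Ma h" for h
  define Y where "Y h = (\<alpha> + \<kappa>) *\<^sub>R h + Mb h" for h
  have "linear X" "linear Y"
    unfolding X_def Y_def
    by (intro linear_compose_add linear_scaleR linMa linMb)+
  moreover have "h \<bullet> X h + k \<bullet> Y k \<le> \<alpha> * (norm (h - k))\<^sup>2 + \<kappa> * ((norm h)\<^sup>2 + (norm k)\<^sup>2)" for h k
  proof -
    \<comment> \<open>The second order form of \<open>w\<close> at the contact point in direction
      \<open>(h, k)\<close>. It is at most 0 because symmetric second differences of
      \<open>w\<close> are at most 0 there; along \<open>t *\<^sub>R (h, k)\<close> everything
      scales with \<open>t\<^sup>2\<close>, and \<tau> makes the remaining error at most
      \<open>e\<close>.\<close>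
    let ?s = "h \<bullet> Ma h + k \<bullet> Mb k + 2 * \<alpha> * (h \<bullet> k)"
    have "?s \<le> 0"
    proof (rule field_le_epsilon)
      fix e :: real assume e: "0 < e"
      define N where "N = (norm h)\<^sup>2 + (norm k)\<^sup>2 + 1"
      define \<tau> where "\<tau> = e / (2 * N)"
      have pos: "N > 0" by (simp add: N_def add_nonneg_pos)
      have \<tau>: "\<tau> > 0" using e pos by (simp add: \<tau>_def)
      obtain d1 where d1: "d1 > 0" "\<And>h. norm h < d1 \<Longrightarrow>
          \<bar>ha (x + h) - ha x - (P1 - \<alpha> *\<^sub>R y) \<bullet> h - h \<bullet> Ma h / 2\<bar> \<le> \<tau> * (norm h)\<^sup>2"
        using expa[OF \<tau>] by blast
      obtain d2 where d2: "d2 > 0" "\<And>h. norm h < d2 \<Longrightarrow>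
          \<bar>hb (y + h) - hb y - (P2 - \<alpha> *\<^sub>R x) \<bullet> h - h \<bullet> Mb h / 2\<bar> \<le> \<tau> * (norm h)\<^sup>2"
        using expb[OF \<tau>] by blast
      define t where "t = min ((d1 / 2) / (norm h + 1)) ((d2 / 2) / (norm k + 1))"
      have t: "t > 0" using d1 d2 by (simp add: t_def add_nonneg_pos)
      have n: "norm h + 1 > 0" "norm k + 1 > 0" by (simp_all add: add_nonneg_pos)
      have "t \<le> (d1 / 2) / (norm h + 1)" "t \<le> (d2 / 2) / (norm k + 1)" unfolding t_def by (rule min.cobounded1, rule min.cobounded2)
      then have "t * (norm h + 1) \<le> d1 / 2" "t * (norm k + 1) \<le> d2 / 2"
        using n by (simp_all only: pos_le_divide_eq)
      then have "t * (norm h + 1) < d1" "t * (norm k + 1) < d2" using d1(1) d2(1) by linarith+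
      with t have th: "norm (t *\<^sub>R h) < d1" and tk: "norm (t *\<^sub>R k) < d2"
        by (simp_all add: algebra_simps)
      have nh: "norm (- (t *\<^sub>R h)) < d1" and nk: "norm (- (t *\<^sub>R k)) < d2" using th tk by simp_all
      have Mt: "(t *\<^sub>R h) \<bullet> Ma (t *\<^sub>R h) = t\<^sup>2 * (h \<bullet> Ma h)" "(- (t *\<^sub>R h)) \<bullet> Ma (- (t *\<^sub>R h)) = t\<^sup>2 * (h \<bullet> Ma h)"
        "(t *\<^sub>R k) \<bullet> Mb (t *\<^sub>R k) = t\<^sup>2 * (k \<bullet> Mb k)" "(- (t *\<^sub>R k)) \<bullet> Mb (- (t *\<^sub>R k)) = t\<^sup>2 * (k \<bullet> Mb k)"
        by (simp_all add: linear_scale[OF linMa] linear_scale[OF linMb] linear_neg[OF linMa] linear_neg[OF linMb] power2_eq_square)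
      have A: "t\<^sup>2 * (h \<bullet> Ma h) - 2 * \<tau> * (t\<^sup>2 * (norm h)\<^sup>2) \<le> ha (x + t *\<^sub>R h) + ha (x + - (t *\<^sub>R h)) - 2 * ha x"
        using d1(2)[OF th] d1(2)[OF nh] unfolding Mt by (simp add: abs_le_iff power_mult_distrib)
      have B: "t\<^sup>2 * (k \<bullet> Mb k) - 2 * \<tau> * (t\<^sup>2 * (norm k)\<^sup>2) \<le> hb (y + t *\<^sub>R k) + hb (y + - (t *\<^sub>R k)) - 2 * hb y"
        using d2(2)[OF tk] d2(2)[OF nk] unfolding Mt by (simp add: abs_le_iff power_mult_distrib)
      have "w (z + t *\<^sub>R (h, k)) + w (z + - (t *\<^sub>R (h, k))) \<le> 2 * w z"
        using contact_w[OF ct, of "t *\<^sub>R (h, k)"] contact_w[OF ct, of "- (t *\<^sub>R (h, k))"] contact_eq[OF ct]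
        unfolding inner_minus_right by linarith
      moreover have "w (z + t *\<^sub>R (h, k)) + w (z + - (t *\<^sub>R (h, k))) - 2 * w z
        = (ha (x + t *\<^sub>R h) + ha (x + - (t *\<^sub>R h)) - 2 * ha x) + (hb (y + t *\<^sub>R k) + hb (y + - (t *\<^sub>R k)) - 2 * hb y)
          + t\<^sup>2 * (2 * \<alpha> * (h \<bullet> k))"
        by (simp add: w_def z inner_add_left inner_add_right inner_diff_left inner_diff_right power2_eq_square algebra_simps)
      ultimately have "t\<^sup>2 * (h \<bullet> Ma h) - 2 * \<tau> * (t\<^sup>2 * (norm h)\<^sup>2) + (t\<^sup>2 * (k \<bullet> Mb k) - 2 * \<tau> * (t\<^sup>2 * (norm k)\<^sup>2))
          + t\<^sup>2 * (2 * \<alpha> * (h \<bullet> k)) \<le> 0" using A B by linarith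
      then have "t\<^sup>2 * ?s \<le> t\<^sup>2 * (2 * \<tau> * ((norm h)\<^sup>2 + (norm k)\<^sup>2))" by (simp add: algebra_simps)
      then have "?s \<le> 2 * \<tau> * ((norm h)\<^sup>2 + (norm k)\<^sup>2)" using t by simp
      also have "\<dots> \<le> 2 * \<tau> * N" using \<tau> by (simp add: N_def)
      also have "\<dots> = 0 + e" using pos by (simp add: \<tau>_def)
      finally show "?s \<le> 0 + e" .
    qed
    then show ?thesis
      by (simp add: X_def Y_def inner_add_right norm_diff_square dot_square_norm algebra_simps)
  qed
  moreover have "\<exists>d>0. \<forall>h. norm h < d \<longrightarrow> \<xi> x + h \<in> C \<longrightarrow>
      v (\<xi> x + h) \<le> v (\<xi> x) + (P1 - \<alpha> *\<^sub>R y + (\<alpha> + \<kappa>) *\<^sub>R x) \<bullet> h + h \<bullet> X h / 2 + \<tau> * (norm h)\<^sup>2" if \<tau>: "0 < \<tau>" for \<tau>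
  proof -
    obtain d where d: "d > 0" "\<And>h. norm h < d \<Longrightarrow>
          \<bar>ha (x + h) - ha x - (P1 - \<alpha> *\<^sub>R y) \<bullet> h - h \<bullet> Ma h / 2\<bar> \<le> \<tau> * (norm h)\<^sup>2"
      using expa[OF \<tau>] by blast
    have "v (\<xi> x + h) \<le> v (\<xi> x) + (P1 - \<alpha> *\<^sub>R y + (\<alpha> + \<kappa>) *\<^sub>R x) \<bullet> h + h \<bullet> X h / 2 + \<tau> * (norm h)\<^sup>2"
      if h: "norm h < d" "\<xi> x + h \<in> C" for h
    proof -
      \<comment> \<open>In the supremum at \<open>x + h\<close> the competitor
        \<open>\<xi> x + h\<close> has the same penalty as \<open>\<xi> x\<close> at
        \<open>x\<close>, so the penalties cancel.\<close>
      have "v (\<xi> x + h) - v (\<xi> x) \<le> a (x + h) - a x" using a(1)[OF h(2), of "x + h"] by (simp add: a(3)[of x])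
      also have "\<dots> = \<psi>a (x + h) - \<psi>a x + ((\<alpha> + \<kappa>) * (x \<bullet> h) + (\<alpha> + \<kappa>) * (norm h)\<^sup>2 / 2)"
        unfolding \<psi>a_def norm_add_square \<beta>_def by (simp add: field_simps)
      also have "\<dots> \<le> ha (x + h) - ha x + ((\<alpha> + \<kappa>) * (x \<bullet> h) + (\<alpha> + \<kappa>) * (norm h)\<^sup>2 / 2)"
        using ha[of "x + h"] eqab(1) by simp
      also have "\<dots> \<le> (P1 - \<alpha> *\<^sub>R y) \<bullet> h + h \<bullet> Ma h / 2 + \<tau> * (norm h)\<^sup>2 + ((\<alpha> + \<kappa>) * (x \<bullet> h) + (\<alpha> + \<kappa>) * (norm h)\<^sup>2 / 2)"
        using d(2)[OF h(1)] by (simp add: abs_le_iff)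
      finally show ?thesis
        by (simp add: X_def inner_add_left inner_add_right dot_square_norm add_divide_distrib)
    qed
    with d(1) show ?thesis by blast
  qed
  moreover have "\<exists>d>0. \<forall>h. norm h < d \<longrightarrow> \<eta> y + h \<in> C \<longrightarrow>
      u (\<eta> y + h) \<le> u (\<eta> y) + (P2 - \<alpha> *\<^sub>R x + (\<alpha> + \<kappa>) *\<^sub>R y) \<bullet> h + h \<bullet> Y h / 2 + \<tau> * (norm h)\<^sup>2" if \<tau>: "0 < \<tau>" for \<tau>
  proof -
    obtain d where d: "d > 0" "\<And>h. norm h < d \<Longrightarrow>
          \<bar>hb (y + h) - hb y - (P2 - \<alpha> *\<^sub>R x) \<bullet> h - h \<bullet> Mb h / 2\<bar> \<le> \<tau> * (norm h)\<^sup>2"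
      using expb[OF \<tau>] by blast
    have "u (\<eta> y + h) \<le> u (\<eta> y) + (P2 - \<alpha> *\<^sub>R x + (\<alpha> + \<kappa>) *\<^sub>R y) \<bullet> h + h \<bullet> Y h / 2 + \<tau> * (norm h)\<^sup>2"
      if h: "norm h < d" "\<eta> y + h \<in> C" for h
    proof -
      have "u (\<eta> y + h) - u (\<eta> y) \<le> b (y + h) - b y" using b(1)[OF h(2), of "y + h"] by (simp add: b(3)[of y])
      also have "\<dots> = \<psi>b (y + h) - \<psi>b y + ((\<alpha> + \<kappa>) * (y \<bullet> h) + (\<alpha> + \<kappa>) * (norm h)\<^sup>2 / 2)"
        unfolding \<psi>b_def norm_add_square \<beta>_def by (simp add: field_simps)
      also have "\<dots> \<le> hb (y + h) - hb y + ((\<alpha> + \<kappa>) * (y \<bullet> h) + (\<alpha> + \<kappa>) * (norm h)\<^sup>2 / 2)"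
        using hb[of "y + h"] eqab(2) by simp
      also have "\<dots> \<le> (P2 - \<alpha> *\<^sub>R x) \<bullet> h + h \<bullet> Mb h / 2 + \<tau> * (norm h)\<^sup>2 + ((\<alpha> + \<kappa>) * (y \<bullet> h) + (\<alpha> + \<kappa>) * (norm h)\<^sup>2 / 2)"
        using d(2)[OF h(1)] by (simp add: abs_le_iff)
      finally show ?thesis
        by (simp add: Y_def inner_add_left inner_add_right dot_square_norm add_divide_distrib)
    qed
    with d(1) show ?thesis by blast
  qed
  moreover have "v x0 + u x0 - \<kappa> * (norm x0 + 1)\<^sup>2
      \<le> v (\<xi> x) + u (\<eta> y) - \<alpha> / 2 * ((norm (x - \<xi> x))\<^sup>2 + (norm (y - \<eta> y))\<^sup>2 + (norm (x - y))\<^sup>2)"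
  proof -
    \<comment> \<open>Comparison of the contact point with \<open>(x0, x0)\<close>: the quadratic
      term at \<open>(x0, x0)\<close> costs \<kappa> |x0|^2, the slope there at most 2 \<kappa>
      |x0|, and the slope at \<open>z\<close>, absorbed by the quadratic term, at most another
      \<kappa>. The total is \<open>\<kappa> * (norm x0 + 1)\<^sup>2\<close>.\<close>
    have nP: "norm P < \<kappa>" using P by simp
    have Wz: "W z = v (\<xi> x) + u (\<eta> y) - \<alpha> / 2 * ((norm (x - \<xi> x))\<^sup>2 + (norm (y - \<eta> y))\<^sup>2 + (norm (x - y))\<^sup>2)
        - \<kappa> / 2 * (norm z)\<^sup>2"
      unfolding W_alt by (simp add: z a(3)[of x] b(3)[of y] algebra_simps)
    have W0: "v x0 + u x0 - \<kappa> * (norm x0)\<^sup>2 \<le> W (x0, x0)"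
      using a(1)[OF x0, of x0] b(1)[OF x0, of x0] unfolding W_alt by (simp add: norm_Pair_square)
    have "W (x0, x0) - P \<bullet> (x0, x0) \<le> W z - P \<bullet> z" using ct by (simp add: contact_def)
    moreover have "P \<bullet> (x0, x0) \<le> \<kappa> * (2 * norm x0)"
    proof -
      have "P \<bullet> (x0, x0) \<le> norm P * norm (x0, x0)" by (rule norm_cauchy_schwarz)
      also have "\<dots> \<le> \<kappa> * (2 * norm x0)"
        using norm_Pair_le[of x0 x0] nP \<kappa> by (intro mult_mono) auto
      finally show ?thesis .
    qed
    moreover have "- (P \<bullet> z) \<le> \<kappa> * norm z"
    proof -
      have "- (P \<bullet> z) \<le> norm P * norm z" using Cauchy_Schwarz_ineq2[of P z] by linarith
      also have "\<dots> \<le> \<kappa> * norm z" using nP by (intro mult_right_mono) auto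
      finally show ?thesis .
    qed
    moreover have "\<kappa> * norm z \<le> \<kappa> / 2 * (norm z)\<^sup>2 + \<kappa>"
    proof -
      have "0 \<le> \<kappa> / 2 * ((norm z - 1)\<^sup>2 + 1)" using \<kappa> by simp
      then show ?thesis by (simp add: power2_eq_square algebra_simps)
    qed
    ultimately have "v x0 + u x0 - \<kappa> * (norm x0)\<^sup>2 - \<kappa> * (2 * norm x0) - \<kappa> \<le> W z + \<kappa> / 2 * (norm z)\<^sup>2"
      using W0 by linarith
    moreover have "\<kappa> * (norm x0 + 1)\<^sup>2 = \<kappa> * (norm x0)\<^sup>2 + \<kappa> * (2 * norm x0) + \<kappa>"
      by (simp add: power2_eq_square algebra_simps)
    ultimately show ?thesis unfolding Wz by linarith
  qed
  ultimately show ?thesis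
    by (intro that[OF a(2)[of x] b(2)[of y], of X Y x y "P1 - \<alpha> *\<^sub>R y + (\<alpha> + \<kappa>) *\<^sub>R x" "P2 - \<alpha> *\<^sub>R x + (\<alpha> + \<kappa>) *\<^sub>R y"])
qed

section \<open>Positive semidefinite matrices and quadratic test functions\<close>

lemma poly_charpoly: "poly (charpoly X) l = det (l *\<^sub>R mat 1 - X)"
  by (simp add: charpoly_def det_def poly_sum poly_prod mat_def if_distrib[where f = "\<lambda>q. poly q l"]
      if_distrib[where f = "\<lambda>q. q - _"] if_distrib[where f = "(*) l"] cong: if_cong)

lemma inner_matrix_vector: "x \<bullet> (B *v y) = (transpose B *v x) \<bullet> (y :: real^'n)"
  for B :: "real^'n^'m"
  by (metis dot_lmul_matrix transpose_matrix_vector)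

lemma quadratic_form_add:
  fixes B :: "real^'n^'n"
  assumes "transpose B = B"
  shows "(x + h) \<bullet> (B *v (x + h)) = x \<bullet> (B *v x) + 2 * ((B *v x) \<bullet> h) + h \<bullet> (B *v h)"
proof -
  have "x \<bullet> (B *v h) = (B *v x) \<bullet> h"
    using inner_matrix_vector[of x B h] assms by simp
  then show ?thesis
    by (simp add: matrix_vector_right_distrib inner_add_left inner_add_right inner_commute)
qed

text \<open>The form attains its minimum 0 at \<open>x\<close>, so the linear term of its expansion
  there, \<open>2 * ((B *v x) \<bullet> h)\<close>, must vanish.\<close>

lemma psd_kernel:
  fixes B :: "real^'n^'n"
  assumes B: "B \<in> psd_matrices" and x: "x \<bullet> (B *v x) = 0"
  shows "B *v x = 0"
proof -
  have sym: "transpose B = B" and pos: "\<And>y. 0 \<le> y \<bullet> (B *v y)"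
    using B by (auto simp: psd_matrices_def sym_matrices_def)
  obtain K where K: "\<And>y. norm (B *v y) \<le> norm y * K"
    using bounded_linear.bounded[OF matrix_vector_mul_bounded_linear[of B]] by blast
  have "(- 2 *\<^sub>R (B *v x)) \<bullet> h \<le> K * (norm h)\<^sup>2" for h
  proof -
    have "0 \<le> (x + h) \<bullet> (B *v (x + h))" by (rule pos)
    then have "(- 2 *\<^sub>R (B *v x)) \<bullet> h \<le> h \<bullet> (B *v h)" by (simp add: quadratic_form_add[OF sym] x)
    also have "\<dots> \<le> norm h * norm (B *v h)" by (rule norm_cauchy_schwarz)
    also have "\<dots> \<le> norm h * (norm h * K)" by (intro mult_left_mono K) auto
    finally show ?thesis by (simp add: power2_eq_square mult_ac)
  qed
  from eq_zero_if_inner_le_square[OF this] show ?thesis by simp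
qed

text \<open>For the maximum \<open>l\<close> of the form on the unit sphere,
  \<open>l *\<^sub>R mat 1 - A\<close> is positive semidefinite and its form vanishes at the
  maximiser, so \<open>psd_kernel\<close> yields an eigenvector. If \<open>l\<close> were 0, the
  same lemma would give \<open>A = 0\<close>.\<close>

lemma psd_nonzero_eigenvalue:
  fixes A :: "real^'n^'n"
  assumes A: "A \<in> psd_matrices" and nz: "A \<noteq> 0"
  obtains l x where "l > 0" "x \<noteq> 0" "A *v x = l *\<^sub>R x"
proof -
  have sym: "transpose A = A" and pos: "\<And>y. 0 \<le> y \<bullet> (A *v y)"
    using A by (auto simp: psd_matrices_def sym_matrices_def)
  have "continuous_on (sphere 0 1) (\<lambda>y. y \<bullet> (A *v y))"
    by (intro continuous_intros matrix_vector_mult_linear_continuous_on)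
  moreover have "sphere (0::real^'n) 1 \<noteq> {}" using vector_choose_size[of 1] by force
  ultimately obtain x where x: "x \<in> sphere 0 1" and max: "\<And>y. y \<in> sphere 0 1 \<Longrightarrow> y \<bullet> (A *v y) \<le> x \<bullet> (A *v x)"
    using continuous_attains_sup[OF compact_sphere] by blast
  define l where "l = x \<bullet> (A *v x)"
  have le: "y \<bullet> (A *v y) \<le> l * (norm y)\<^sup>2" for y
  proof (cases "y = 0")
    case False
    have "((1 / norm y) *\<^sub>R y) \<bullet> (A *v ((1 / norm y) *\<^sub>R y)) \<le> l"
      unfolding l_def by (rule max) (use False in simp)
    then have "(y \<bullet> (A *v y)) / (norm y)\<^sup>2 \<le> l"
      by (simp add: matrix_vector_mult_scaleR power2_eq_square)
    then show ?thesis using False by (simp add: field_simps)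
  qed simp
  have "l \<noteq> 0"
  proof
    assume "l = 0"
    then have "y \<bullet> (A *v y) = 0" for y using le[of y] pos[of y] by simp
    then have "A *v y = 0" for y by (rule psd_kernel[OF A])
    then have "A = 0" by (simp add: matrix_eq)
    with nz show False by simp
  qed
  then have l: "l > 0" using pos[of x] by (simp add: l_def)
  define B where "B = l *\<^sub>R mat 1 - A"
  have Bv: "B *v y = l *\<^sub>R y - A *v y" for y
    by (simp add: B_def matrix_vector_mult_diff_rdistrib scaleR_matrix_vector_assoc[symmetric])
  have "transpose B = B"
    using sym by (simp add: B_def transpose_def vec_eq_iff mat_def) 
  then have "B \<in> psd_matrices"
    using le by (auto simp: psd_matrices_def sym_matrices_def Bv inner_diff_right dot_square_norm)
  moreover have "x \<bullet> (B *v x) = 0" using x by (simp add: Bv inner_diff_right dot_square_norm l_def)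
  ultimately have "B *v x = 0" by (rule psd_kernel)
  then have "A *v x = l *\<^sub>R x" by (simp add: Bv)
  moreover have "x \<noteq> 0" using x by auto
  ultimately show ?thesis using that[of l x] l by auto
qed

lemma det_eq_zero_iff_kernel: "det (B :: real^'n^'n) = 0 \<longleftrightarrow> (\<exists>x. x \<noteq> 0 \<and> B *v x = 0)"
  using invertible_det_nz[of B] matrix_left_invertible_ker[of B] invertible_left_inverse[of B] by blast

lemma trace_norm_pos:
  fixes A :: "real^'n^'n"
  assumes A: "A \<in> psd_matrices" and nz: "A \<noteq> 0"
  shows "trace_norm A > 0"
proof -
  obtain l x where l: "l > 0" "x \<noteq> 0" "A *v x = l *\<^sub>R x"
    using psd_nonzero_eigenvalue[OF A nz] .
  have Bv: "(m *\<^sub>R mat 1 - A) *v y = m *\<^sub>R y - A *v y" for m y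
    by (simp add: matrix_vector_mult_diff_rdistrib scaleR_matrix_vector_assoc[symmetric])
  have root: "poly (charpoly A) l = 0"
    unfolding poly_charpoly det_eq_zero_iff_kernel by (rule exI[of _ x]) (simp add: Bv l)
  \<comment> \<open>\<open>proots\<close> is empty for the zero polynomial, so that case has to be
    excluded; -1 is not an eigenvalue of a positive semidefinite matrix.\<close>
  have "poly (charpoly A) (- 1) \<noteq> 0"
    unfolding poly_charpoly det_eq_zero_iff_kernel
  proof clarify
    fix y assume y: "y \<noteq> 0" "((- 1) *\<^sub>R mat 1 - A) *v y = 0"
    then have "- y = A *v y" unfolding Bv by simp
    then have "y \<bullet> (A *v y) = - (y \<bullet> y)" by (metis inner_minus_right)
    then have "y \<bullet> (A *v y) < 0" using y(1) by simp
    then show False using A by (auto simp: psd_matrices_def not_le[symmetric])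
  qed
  then have "charpoly A \<noteq> 0" by auto
  with root have "l \<in># proots (charpoly A)" by simp
  then obtain N where N: "proots (charpoly A) = add_mset l N" by (meson multi_member_split)
  have "(\<Sum>a\<in>#N. \<bar>a\<bar>) \<ge> 0" by (induction N) auto
  then show ?thesis using l(1) by (simp add: trace_norm_def N)
qed

section \<open>Factorised operators and quadratic test functions\<close>

lemma matrix_columns_norm: "(\<Sum>k\<in>UNIV. (norm (column k Q))\<^sup>2) = (norm (Q :: real^'m^'n))\<^sup>2"
proof -
  have "(\<Sum>k\<in>UNIV. (norm (column k Q))\<^sup>2) = (\<Sum>k\<in>UNIV. \<Sum>i\<in>UNIV. (Q $ i $ k)\<^sup>2)"
    unfolding power2_norm_eq_inner by (simp add: inner_vec_def column_def power2_eq_square)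
  also have "\<dots> = (\<Sum>i\<in>UNIV. \<Sum>k\<in>UNIV. (Q $ i $ k)\<^sup>2)" by (rule sum.swap)
  also have "\<dots> = (norm Q)\<^sup>2"
    unfolding power2_norm_eq_inner by (simp add: inner_vec_def power2_eq_square)
  finally show ?thesis .
qed

text \<open>The factorisation turns the operator into a sum of second derivatives along the columns
  of \<open>Q\<close>, the form in which the coupled inequality for quadratic forms can be
  applied.\<close>

lemma trace_gram_mult:
  fixes Q :: "real^'m^'n" and S :: "real^'n^'n"
  shows "trace ((Q ** transpose Q) ** S) = (\<Sum>k\<in>UNIV. column k Q \<bullet> (S *v column k Q))"
proof -
  have "trace ((Q ** transpose Q) ** S) = (\<Sum>i\<in>UNIV. \<Sum>j\<in>UNIV. \<Sum>k\<in>UNIV. Q $ i $ k * Q $ j $ k * S $ j $ i)"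
    by (simp add: trace_def matrix_matrix_mult_def transpose_def sum_distrib_right)
  also have "\<dots> = (\<Sum>i\<in>UNIV. \<Sum>k\<in>UNIV. \<Sum>j\<in>UNIV. Q $ i $ k * Q $ j $ k * S $ j $ i)"
    by (rule sum.cong[OF refl sum.swap])
  also have "\<dots> = (\<Sum>k\<in>UNIV. \<Sum>i\<in>UNIV. \<Sum>j\<in>UNIV. Q $ i $ k * Q $ j $ k * S $ j $ i)"
    by (rule sum.swap)
  also have "\<dots> = (\<Sum>k\<in>UNIV. \<Sum>j\<in>UNIV. \<Sum>i\<in>UNIV. Q $ i $ k * Q $ j $ k * S $ j $ i)"
    by (rule sum.cong[OF refl sum.swap])
  also have "\<dots> = (\<Sum>k\<in>UNIV. column k Q \<bullet> (S *v column k Q))"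
    by (simp add: inner_vec_def column_def matrix_vector_mult_def sum_distrib_left mult_ac)
  finally show ?thesis .
qed

lemma quadratic_test_function:
  fixes S :: "real^'n^'n"
    and \<phi> :: "real^'n \<Rightarrow> real"
  assumes S: "transpose S = S"
    and \<phi>_def: "\<phi> = (\<lambda>x. c + p \<bullet> (x - x0) + (x - x0) \<bullet> (S *v (x - x0)) / 2)"
  shows "hessian \<phi> x = S" and "C2_near \<phi> y"
proof -
  have d: "(\<phi> has_derivative (\<lambda>h. (p + S *v (x - x0)) \<bullet> h)) (at x)" for x
  proof -
    have "((\<lambda>x. S *v (x - x0)) has_derivative (\<lambda>h. S *v h)) (at x)"
      by (rule bounded_linear.has_derivative[OF matrix_vector_mul_bounded_linear])
        (auto intro!: derivative_eq_intros)
    then have "(\<phi> has_derivative (\<lambda>h. p \<bullet> h + ((x - x0) \<bullet> (S *v h) + h \<bullet> (S *v (x - x0))) / 2)) (at x)"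
      unfolding \<phi>_def by (auto intro!: derivative_eq_intros)
    moreover have "(x - x0) \<bullet> (S *v h) = (S *v (x - x0)) \<bullet> h" for h
      using inner_matrix_vector[of "x - x0" S h] S by simp
    then have "(\<lambda>h. p \<bullet> h + ((x - x0) \<bullet> (S *v h) + h \<bullet> (S *v (x - x0))) / 2) = (\<lambda>h. (p + S *v (x - x0)) \<bullet> h)"
      by (simp add: fun_eq_iff inner_add_left inner_commute[of _ "S *v (x - x0)"])
    ultimately show ?thesis by simp
  qed
  have g: "gradient \<phi> x = p + S *v (x - x0)" for x
  proof -
    have "frechet_derivative \<phi> (at x) = (\<lambda>h. (p + S *v (x - x0)) \<bullet> h)"
      using frechet_derivative_at[OF d] by simp
    then show ?thesis by (simp add: gradient_def vec_eq_iff inner_axis)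
  qed
  have dg: "(gradient \<phi> has_derivative (\<lambda>h. S *v h)) (at x)" for x
  proof -
    have "((\<lambda>x. p + S *v (x - x0)) has_derivative (\<lambda>h. 0 + S *v h)) (at x)"
      by (intro has_derivative_add has_derivative_const
          bounded_linear.has_derivative[OF matrix_vector_mul_bounded_linear])
        (auto intro!: derivative_eq_intros)
    moreover have "gradient \<phi> = (\<lambda>x. p + S *v (x - x0))" by (rule ext) (rule g)
    ultimately show ?thesis by simp
  qed
  show h: "hessian \<phi> x = S" for x
    using frechet_derivative_at[OF dg] by (simp add: hessian_def)
  show "C2_near \<phi> y"
    unfolding C2_near_def
  proof (intro exI[of _ UNIV] conjI)
    show "\<phi> differentiable_on UNIV" using d by (auto simp: differentiable_on_def differentiable_def)
    show "gradient \<phi> differentiable_on UNIV" using dg by (auto simp: differentiable_on_def differentiable_def)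
    show "continuous_on UNIV (hessian \<phi>)" by (simp add: h)
  qed auto
qed

text \<open>The jet holds only up to \<tau> |h|^2, so it is not itself a test function; a slightly
  larger quadratic is one, and \<tau> then tends to 0. The abstract hypothesis \<open>test\<close>
  serves both \<open>v\<close> with right-hand side \<open>f\<close> and \<open>- u\<close> with
  \<open>- f\<close>.\<close>

lemma quadratic_jet_inequality:
  fixes Q :: "real^'m^'n" and X :: "real^'n \<Rightarrow> real^'n"
  assumes test: "\<And>p S. transpose S = S \<Longrightarrow>
      (\<forall>\<^sub>F x in at x0 within \<Omega>. v x \<le> v x0 + p \<bullet> (x - x0) + (x - x0) \<bullet> (S *v (x - x0)) / 2) \<Longrightarrow>
      f0 \<le> trace (A ** S)"
    and X: "linear X"
    and jet: "\<And>\<tau>. 0 < \<tau> \<Longrightarrow> \<exists>d>0. \<forall>h. norm h < d \<longrightarrow> x0 + h \<in> closure \<Omega> \<longrightarrow>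
      v (x0 + h) \<le> v x0 + p \<bullet> h + h \<bullet> X h / 2 + \<tau> * (norm h)\<^sup>2"
    and t: "0 < t" and A: "A /\<^sub>R t = Q ** transpose Q"
  shows "f0 / t \<le> (\<Sum>k\<in>UNIV. column k Q \<bullet> X (column k Q))"
proof (rule field_le_epsilon)
  fix e :: real assume e: "0 < e"
  define N where "N = (norm Q)\<^sup>2 + 1"
  have N: "N > 0" by (simp add: N_def add_nonneg_pos)
  define \<tau> where "\<tau> = e / (2 * N)"
  have \<tau>: "\<tau> > 0" using e N by (simp add: \<tau>_def)
  \<comment> \<open>Symmetrising leaves the quadratic form unchanged and makes \<open>S\<close>
    admissible as a Hessian. The factor 2 in front of \<tau> compensates for the division by 2 in
    the test function.\<close>
  define S where "S = (1/2) *\<^sub>R (matrix X + transpose (matrix X)) + (2 * \<tau>) *\<^sub>R mat 1"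
  have Sh: "h \<bullet> (S *v h) = h \<bullet> X h + 2 * \<tau> * (norm h)\<^sup>2" for h
  proof -
    have "h \<bullet> (transpose (matrix X) *v h) = h \<bullet> (matrix X *v h)"
      by (metis inner_matrix_vector inner_commute)
    moreover have "matrix X *v h = X h" by (rule fun_cong[OF matrix_vector_mul(2)[OF X]])
    ultimately show ?thesis
      by (simp add: S_def matrix_vector_mult_add_rdistrib scaleR_matrix_vector_assoc[symmetric]
          inner_add_right dot_square_norm)
  qed
  have "transpose S = S"
    by (simp add: S_def transpose_def vec_eq_iff mat_def)
  moreover obtain d where d: "d > 0" "\<And>h. norm h < d \<Longrightarrow> x0 + h \<in> closure \<Omega> \<Longrightarrow>
      v (x0 + h) \<le> v x0 + p \<bullet> h + h \<bullet> X h / 2 + \<tau> * (norm h)\<^sup>2"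
    using jet[OF \<tau>] by blast
  have "\<forall>\<^sub>F x in at x0 within \<Omega>. v x \<le> v x0 + p \<bullet> (x - x0) + (x - x0) \<bullet> (S *v (x - x0)) / 2"
    unfolding eventually_at
  proof (intro exI[of _ d] conjI ballI impI)
    fix x assume "x \<in> \<Omega>" "x \<noteq> x0 \<and> dist x x0 < d"
    then show "v x \<le> v x0 + p \<bullet> (x - x0) + (x - x0) \<bullet> (S *v (x - x0)) / 2"
      using d(2)[of "x - x0"] closure_subset[of \<Omega>] by (auto simp: Sh dist_norm add_divide_distrib)
  qed (rule d)
  ultimately have "f0 \<le> trace (A ** S)" by (rule test)
  also have "A = t *\<^sub>R (Q ** transpose Q)" using t by (simp add: A[symmetric])
  also have "trace (t *\<^sub>R (Q ** transpose Q) ** S) = t * trace ((Q ** transpose Q) ** S)"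
    by (simp add: scalar_matrix_assoc[symmetric] trace_def sum_distrib_left)
  finally have "f0 / t \<le> trace ((Q ** transpose Q) ** S)" using t by (simp add: field_simps)
  also have "\<dots> = (\<Sum>k\<in>UNIV. column k Q \<bullet> X (column k Q)) + 2 * \<tau> * (norm Q)\<^sup>2"
    by (simp add: trace_gram_mult Sh sum.distrib sum_distrib_left[symmetric] matrix_columns_norm)
  also have "2 * \<tau> * (norm Q)\<^sup>2 \<le> 2 * \<tau> * N" using \<tau> by (simp add: N_def)
  also have "2 * \<tau> * N = e" using N by (simp add: \<tau>_def)
  finally show "f0 / t \<le> (\<Sum>k\<in>UNIV. column k Q \<bullet> X (column k Q)) + e" by simp
qed

section \<open>The comparison principle\<close>

lemma usc_on_add:
  assumes v: "usc_on C v" and u: "usc_on C u"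
  shows "usc_on C (\<lambda>x. v x + u x)"
  unfolding usc_on_def
proof (intro ballI allI impI)
  fix x c assume x: "x \<in> C" and less: "v x + u x < c"
  define e where "e = (c - v x - u x) / 2"
  have e: "e > 0" using less by (simp add: e_def)
  have "\<forall>\<^sub>F y in at x within C. v y < v x + e" using v x e by (auto simp: usc_on_def)
  moreover have "\<forall>\<^sub>F y in at x within C. u y < u x + e" using u x e by (auto simp: usc_on_def)
  ultimately show "\<forall>\<^sub>F y in at x within C. v y + u y < c"
    by eventually_elim (auto simp: e_def field_simps)
qed

lemma usc_on_uminus:
  assumes "lsc_on C u"
  shows "usc_on C (\<lambda>x. - u x)"
  unfolding usc_on_def
proof (intro ballI allI impI)
  fix x c assume "x \<in> C" "- u x < c"
  then have "\<forall>\<^sub>F y in at x within C. - c < u y"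
    using assms[unfolded lsc_on_def, rule_format, of x "- c"] by simp
  then show "\<forall>\<^sub>F y in at x within C. - u y < c" by eventually_elim simp
qed

lemma usc_on_eventually_less:
  assumes "usc_on C (v :: 'a::metric_space \<Rightarrow> real)" "l \<in> C" "v l < c"
    and "\<And>n. a n \<in> C" "a \<longlonglongrightarrow> l"
  shows "\<forall>\<^sub>F n in sequentially. v (a n) < c"
proof -
  obtain d where d: "d > 0" "\<forall>y\<in>C. dist y l < d \<longrightarrow> v y < c"
    using usc_on_ball[OF assms(1-3)] by blast
  from tendstoD[OF assms(5) d(1)] show ?thesis
    by eventually_elim (use d(2) assms(4) in auto)
qed

lemma locally_lipschitz_on_imp_continuous_on:
  assumes S: "open S" and Q: "locally_lipschitz_on S Q"
  shows "continuous_on S Q"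
proof (rule continuous_at_imp_continuous_on, rule ballI)
  fix x assume x: "x \<in> S"
  obtain r L where r: "r > 0" "L-lipschitz_on (ball x r \<inter> S) Q"
    using Q x unfolding locally_lipschitz_on_def by blast
  have "continuous_on (ball x r \<inter> S) Q" using r(2) by (rule lipschitz_on_continuous_on)
  moreover have "open (ball x r \<inter> S)" using S by blast
  ultimately show "isCont Q x" using x r(1) by (simp add: continuous_on_eq_continuous_at)
qed

lemma subsolution_quadratic_test:
  fixes A :: "real^'n \<Rightarrow> real^'n^'n"
  assumes "viscosity_subsolution (\<lambda>X x. trace (A x ** X) - f x) \<Omega> v" "x0 \<in> \<Omega>" "transpose S = S"
    and "\<forall>\<^sub>F x in at x0 within \<Omega>. v x \<le> v x0 + p \<bullet> (x - x0) + (x - x0) \<bullet> (S *v (x - x0)) / 2"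
  shows "f x0 \<le> trace (A x0 ** S)"
proof -
  define \<phi> where "\<phi> = (\<lambda>x. v x0 + p \<bullet> (x - x0) + (x - x0) \<bullet> (S *v (x - x0)) / 2)"
  note q = quadratic_test_function[OF assms(3) \<phi>_def]
  have "\<phi> x0 = v x0" by (simp add: \<phi>_def)
  with assms(1,2,4) q(2)[of x0] have "0 \<le> trace (A x0 ** hessian \<phi> x0) - f x0"
    unfolding viscosity_subsolution_def \<phi>_def[symmetric] by (auto simp: \<phi>_def)
  then show ?thesis by (simp add: q(1))
qed

text \<open>Touching \<open>- u\<close> from above is touching \<open>u\<close> from below with
  \<open>p\<close> and \<open>S\<close> negated. This form lets both solutions enter
  \<open>coupled_jets\<close> and \<open>quadratic_jet_inequality\<close> as upper semicontinuous
  functions.\<close>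

lemma supersolution_quadratic_test:
  fixes A :: "real^'n \<Rightarrow> real^'n^'n"
  assumes "viscosity_supersolution (\<lambda>X x. trace (A x ** X) - f x) \<Omega> u" "x0 \<in> \<Omega>" "transpose S = S"
    and "\<forall>\<^sub>F x in at x0 within \<Omega>. - u x \<le> - u x0 + p \<bullet> (x - x0) + (x - x0) \<bullet> (S *v (x - x0)) / 2"
  shows "- f x0 \<le> trace (A x0 ** S)"
proof -
  have S: "transpose (- S) = - S" using assms(3) by (simp add: transpose_def vec_eq_iff)
  define \<phi> where "\<phi> = (\<lambda>x. u x0 + (- p) \<bullet> (x - x0) + (x - x0) \<bullet> ((- S) *v (x - x0)) / 2)"
  note q = quadratic_test_function[OF S \<phi>_def]
  have neg: "(- S) *v y = - (S *v y)" for y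
    by (simp add: matrix_vector_mult_def vec_eq_iff sum_negf)
  have "\<forall>\<^sub>F x in at x0 within \<Omega>. \<phi> x \<le> u x"
    using assms(4) by eventually_elim (simp add: \<phi>_def neg)
  moreover have "\<phi> x0 = u x0" by (simp add: \<phi>_def)
  ultimately have "trace (A x0 ** hessian \<phi> x0) - f x0 \<le> 0"
    using assms(1,2) q(2)[of x0] unfolding viscosity_supersolution_def by blast
  then show ?thesis by (simp add: q(1) trace_def matrix_matrix_mult_def sum_negf)
qed

text \<open>In truth the trace norm of such a matrix is its trace and \<open>norm Q\<close> is 1.
  The identity below replaces that fact without a spectral decomposition, expressing the trace norm
  through the continuous quantities \<open>trace A\<close> and \<open>norm Q\<close>.\<close>

lemma trace_psd_eq:
  fixes A :: "real^'n^'n" and Q :: "real^'m^'n"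
  assumes A: "A \<in> psd_matrices" "A \<noteq> 0" and Q: "A /\<^sub>R trace_norm A = Q ** transpose Q"
  shows "trace A = trace_norm A * (norm Q)\<^sup>2" and "Q \<noteq> 0"
proof -
  have t: "trace_norm A > 0" using trace_norm_pos[OF A] .
  then have A_eq: "A = trace_norm A *\<^sub>R (Q ** transpose Q)" by (simp add: Q[symmetric])
  have "trace (Q ** transpose Q) = (norm Q)\<^sup>2"
    using trace_gram_mult[of Q "mat 1"]
    by (simp add: dot_square_norm matrix_columns_norm)
  then show "trace A = trace_norm A * (norm Q)\<^sup>2"
    by (subst A_eq) (simp add: trace_def sum_distrib_left[symmetric])
  show "Q \<noteq> 0"
  proof
    assume "Q = 0"
    then have "Q ** transpose Q = 0" by (simp add: matrix_matrix_mult_def vec_eq_iff)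
    with A_eq A(2) show False by simp
  qed
qed

theorem proposition2p4:
  fixes \<Omega> :: "(real^'n) set"
    and A :: "real^'n \<Rightarrow> real^'n^'n"
    and f :: "real^'n \<Rightarrow> real"
    and Q :: "real^'n \<Rightarrow> real^'m^'n"
  assumes "open \<Omega>" and "bounded \<Omega>"
    and "A \<in> \<Omega> \<rightarrow> psd_matrices - {0}"
    and "continuous_on \<Omega> A" and "continuous_on \<Omega> f"
    and "locally_lipschitz_on \<Omega> Q"
    and "\<And>x. x \<in> \<Omega> \<Longrightarrow> A x /\<^sub>R trace_norm (A x) = Q x ** transpose (Q x)"
  shows "comparison_principle (\<lambda>X x. trace (A x ** X) - f x) \<Omega>"
  unfolding comparison_principle_def
proof (intro allI impI ballI, elim conjE)
  fix v u x1
  assume sub: "viscosity_subsolution (\<lambda>X x. trace (A x ** X) - f x) \<Omega> v"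
    and super: "viscosity_supersolution (\<lambda>X x. trace (A x ** X) - f x) \<Omega> u"
    and bd: "\<forall>x\<in>frontier \<Omega>. v x \<le> u x" and x1: "x1 \<in> \<Omega>"
  note factor = assms(7)
  have Apsd: "A x \<in> psd_matrices" "A x \<noteq> 0" if "x \<in> \<Omega>" for x using assms(3) that by auto
  have tpos: "trace_norm (A x) > 0" if "x \<in> \<Omega>" for x using trace_norm_pos[OF Apsd[OF that]] .
  have Qnz: "Q x \<noteq> 0" if "x \<in> \<Omega>" for x using trace_psd_eq(2)[OF Apsd[OF that] factor[OF that]] .
  have tr: "trace (A x) = trace_norm (A x) * (norm (Q x))\<^sup>2" if "x \<in> \<Omega>" for x
    using trace_psd_eq(1)[OF Apsd[OF that] factor[OF that]] .
  have trpos: "trace (A x) > 0" if "x \<in> \<Omega>" for x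
    using tr[OF that] tpos[OF that] Qnz[OF that] by simp
  have contQ: "continuous_on \<Omega> Q" by (rule locally_lipschitz_on_imp_continuous_on[OF assms(1,6)])
  define g where "g x = f x * (norm (Q x))\<^sup>2 / trace (A x)" for x
  have g_eq: "f x / trace_norm (A x) = g x" if "x \<in> \<Omega>" for x
    using tr[OF that] Qnz[OF that] by (simp add: g_def)
  have contg: "continuous_on \<Omega> g"
    unfolding g_def
  proof (rule continuous_on_divide)
    show "continuous_on \<Omega> (\<lambda>x. f x * (norm (Q x))\<^sup>2)" by (intro continuous_intros assms(5) contQ)
    show "continuous_on \<Omega> (\<lambda>x. trace (A x))" unfolding trace_def by (intro continuous_intros assms(4))
  qed (use trpos in force)
  show "v x1 \<le> u x1"
  proof (rule ccontr)
    assume "\<not> v x1 \<le> u x1"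
    define m where "m = v x1 - u x1"
    have m: "m > 0" using \<open>\<not> v x1 \<le> u x1\<close> by (simp add: m_def)
    define K where "K = closure \<Omega>"
    have \<Omega>K: "\<Omega> \<subseteq> K" by (simp add: K_def closure_subset)
    have compK: "compact K" using assms(2) by (simp add: K_def compact_closure)
    then have "bounded K" by (rule compact_imp_bounded)
    then obtain R where R: "R > 0" "\<And>x. x \<in> K \<Longrightarrow> norm x \<le> R" unfolding bounded_pos by blast
    \<comment> \<open>On \<open>K\<close> the perturbation is then at most \<open>m / 2\<close>, so
      \<open>V + U\<close> cannot reach its maximum, which is at least \<open>m\<close>, on the
      boundary.\<close>
    define \<epsilon> where "\<epsilon> = m / (2 * R\<^sup>2)"
    have \<epsilon>: "\<epsilon> > 0" using m R by (simp add: \<epsilon>_def)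
    define V where "V x = v x + \<epsilon> * (norm x)\<^sup>2" for x
    define U where "U x = - u x" for x
    have uscV: "usc_on K V"
      unfolding V_def using sub
      by (intro usc_on_add_continuous continuous_intros) (simp add: K_def viscosity_subsolution_def)
    have uscU: "usc_on K U"
      unfolding U_def using super
      by (intro usc_on_uminus) (simp add: K_def viscosity_supersolution_def)
    have K0: "K \<noteq> {}" using x1 \<Omega>K by blast
    obtain x0 where x0: "x0 \<in> K" "\<And>y. y \<in> K \<Longrightarrow> V y + U y \<le> V x0 + U x0"
      using usc_on_attains_sup[OF usc_on_add[OF uscV uscU] compK K0] by blast
    define M where "M = V x0 + U x0"
    have mM: "m \<le> M"
    proof -
      have "0 \<le> \<epsilon> * (norm x1)\<^sup>2" using \<epsilon> by simp
      then show ?thesis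
        using x0(2)[of x1] x1 \<Omega>K by (auto simp: M_def m_def V_def U_def)
    qed
    define c where "c = (norm x0 + 1)\<^sup>2"
    have c: "c \<ge> 0" by (simp add: c_def)
    \<comment> \<open>\<open>coupled_jets\<close> is used with \<kappa> = 1 / \<alpha>, so its
      errors vanish as \<alpha> grows. Merging the three distances by (s + t + r)^2 \<le> 3 (s^2 +
      t^2 + r^2) turns \<alpha> / 2 into \<alpha> / 6. The differential inequality is conditional
      because the points may still lie on the boundary.\<close>
    have step: "\<exists>\<xi> \<eta>. \<xi> \<in> K \<and> \<eta> \<in> K \<and> M - c / \<alpha> \<le> V \<xi> + U \<eta> - \<alpha> / 6 * (norm (\<xi> - \<eta>))\<^sup>2 \<and>
        (\<xi> \<in> \<Omega> \<longrightarrow> \<eta> \<in> \<Omega> \<longrightarrow> g \<xi> - g \<eta> + 2 * \<epsilon> * (norm (Q \<xi>))\<^sup>2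
          \<le> \<alpha> * (norm (Q \<xi> - Q \<eta>))\<^sup>2 + 1 / \<alpha> * ((norm (Q \<xi>))\<^sup>2 + (norm (Q \<eta>))\<^sup>2))"
      if \<alpha>: "\<alpha> > 0" for \<alpha>
    proof -
      have \<kappa>: "1 / \<alpha> > 0" using \<alpha> by simp
      obtain x y \<xi> \<eta> p r X Y where \<xi>: "\<xi> \<in> K" and \<eta>: "\<eta> \<in> K" and linX: "linear X" and linY: "linear Y"
        and pen: "V x0 + U x0 - 1 / \<alpha> * (norm x0 + 1)\<^sup>2
          \<le> V \<xi> + U \<eta> - \<alpha> / 2 * ((norm (x - \<xi>))\<^sup>2 + (norm (y - \<eta>))\<^sup>2 + (norm (x - y))\<^sup>2)"
        and jX: "\<And>\<tau>. 0 < \<tau> \<Longrightarrow> \<exists>d>0. \<forall>h. norm h < d \<longrightarrow> \<xi> + h \<in> K \<longrightarrow>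
          V (\<xi> + h) \<le> V \<xi> + p \<bullet> h + h \<bullet> X h / 2 + \<tau> * (norm h)\<^sup>2"
        and jY: "\<And>\<tau>. 0 < \<tau> \<Longrightarrow> \<exists>d>0. \<forall>h. norm h < d \<longrightarrow> \<eta> + h \<in> K \<longrightarrow>
          U (\<eta> + h) \<le> U \<eta> + r \<bullet> h + h \<bullet> Y h / 2 + \<tau> * (norm h)\<^sup>2"
        and XY: "\<And>h k. h \<bullet> X h + k \<bullet> Y k \<le> \<alpha> * (norm (h - k))\<^sup>2 + 1 / \<alpha> * ((norm h)\<^sup>2 + (norm k)\<^sup>2)"
        by (rule coupled_jets[OF uscV uscU compK x0(1) \<alpha> \<kappa>]) (rule that; assumption)
      have "M - c / \<alpha> \<le> V \<xi> + U \<eta> - \<alpha> / 6 * (norm (\<xi> - \<eta>))\<^sup>2"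
      proof -
        define a1 a2 a3 where "a1 = norm (x - \<xi>)" and "a2 = norm (y - \<eta>)" and "a3 = norm (x - y)"
        have "norm (\<xi> - \<eta>) \<le> a1 + a2 + a3"
          unfolding a1_def a2_def a3_def by norm
        then have "(norm (\<xi> - \<eta>))\<^sup>2 \<le> (a1 + a2 + a3)\<^sup>2" by (intro power_mono) auto
        also have "\<dots> \<le> 3 * (a1\<^sup>2 + a2\<^sup>2 + a3\<^sup>2)"
          using sum_squares_bound[of a1 a2] sum_squares_bound[of a1 a3] sum_squares_bound[of a2 a3]
          by (simp add: power2_eq_square algebra_simps)
        finally have "\<alpha> / 6 * (norm (\<xi> - \<eta>))\<^sup>2 \<le> \<alpha> / 6 * (3 * (a1\<^sup>2 + a2\<^sup>2 + a3\<^sup>2))"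
          using \<alpha> by (intro mult_left_mono) auto
        also have "\<dots> = \<alpha> / 2 * (a1\<^sup>2 + a2\<^sup>2 + a3\<^sup>2)" by simp
        finally have "\<alpha> / 6 * (norm (\<xi> - \<eta>))\<^sup>2 \<le> \<alpha> / 2 * (a1\<^sup>2 + a2\<^sup>2 + a3\<^sup>2)" .
        moreover have "c / \<alpha> = 1 / \<alpha> * (norm x0 + 1)\<^sup>2" by (simp add: c_def)
        ultimately show ?thesis using pen unfolding a1_def a2_def a3_def M_def by linarith
      qed
      moreover have "g \<xi> - g \<eta> + 2 * \<epsilon> * (norm (Q \<xi>))\<^sup>2
          \<le> \<alpha> * (norm (Q \<xi> - Q \<eta>))\<^sup>2 + 1 / \<alpha> * ((norm (Q \<xi>))\<^sup>2 + (norm (Q \<eta>))\<^sup>2)"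
        if \<xi>\<Omega>: "\<xi> \<in> \<Omega>" and \<eta>\<Omega>: "\<eta> \<in> \<Omega>"
      proof -
        let ?q = "\<lambda>k. column k (Q \<xi>)" and ?r = "\<lambda>k. column k (Q \<eta>)"
        \<comment> \<open>Removing the Hessian of \<epsilon> |x|^2 gives a jet of \<open>v\<close>
          itself, the function the equation speaks about.\<close>
        define X' where "X' h = X h - (2 * \<epsilon>) *\<^sub>R h" for h
        have linX': "linear X'"
          unfolding X'_def by (intro linear_compose_sub linX linear_scaleR)
        have jX': "\<exists>d>0. \<forall>h. norm h < d \<longrightarrow> \<xi> + h \<in> closure \<Omega> \<longrightarrow>
          v (\<xi> + h) \<le> v \<xi> + (p - (2 * \<epsilon>) *\<^sub>R \<xi>) \<bullet> h + h \<bullet> X' h / 2 + \<tau> * (norm h)\<^sup>2" if \<tau>: "0 < \<tau>" for \<tau>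
        proof -
          obtain d where d: "d > 0" "\<And>h. norm h < d \<Longrightarrow> \<xi> + h \<in> K \<Longrightarrow>
              V (\<xi> + h) \<le> V \<xi> + p \<bullet> h + h \<bullet> X h / 2 + \<tau> * (norm h)\<^sup>2" using jX[OF \<tau>] by blast
          have "v (\<xi> + h) \<le> v \<xi> + (p - (2 * \<epsilon>) *\<^sub>R \<xi>) \<bullet> h + h \<bullet> X' h / 2 + \<tau> * (norm h)\<^sup>2"
            if h: "norm h < d" "\<xi> + h \<in> K" for h
          proof -
            have "h \<bullet> X' h / 2 = h \<bullet> X h / 2 - \<epsilon> * (norm h)\<^sup>2"
              by (simp add: X'_def inner_diff_right dot_square_norm diff_divide_distrib)
            moreover have "\<epsilon> * (norm (\<xi> + h))\<^sup>2 = \<epsilon> * (norm \<xi>)\<^sup>2 + 2 * \<epsilon> * (\<xi> \<bullet> h) + \<epsilon> * (norm h)\<^sup>2"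
              unfolding norm_add_square by (simp add: algebra_simps)
            moreover have "(p - (2 * \<epsilon>) *\<^sub>R \<xi>) \<bullet> h = p \<bullet> h - 2 * \<epsilon> * (\<xi> \<bullet> h)"
              by (simp add: inner_diff_left)
            ultimately show ?thesis using d(2)[OF h] unfolding V_def by linarith
          qed
          with d(1) show ?thesis unfolding K_def by blast
        qed
        have "f \<xi> / trace_norm (A \<xi>) \<le> (\<Sum>k\<in>UNIV. ?q k \<bullet> X' (?q k))"
          by (rule quadratic_jet_inequality[OF _ linX' jX' tpos[OF \<xi>\<Omega>] factor[OF \<xi>\<Omega>]])
            (rule subsolution_quadratic_test[OF sub \<xi>\<Omega>])
        then have 1: "g \<xi> + 2 * \<epsilon> * (norm (Q \<xi>))\<^sup>2 \<le> (\<Sum>k\<in>UNIV. ?q k \<bullet> X (?q k))"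
          unfolding g_eq[OF \<xi>\<Omega>]
          by (simp add: X'_def inner_diff_right dot_square_norm sum_subtractf
              sum_distrib_left[symmetric] matrix_columns_norm)
        have "- f \<eta> / trace_norm (A \<eta>) \<le> (\<Sum>k\<in>UNIV. ?r k \<bullet> Y (?r k))"
          by (rule quadratic_jet_inequality[OF _ linY jY[unfolded K_def] tpos[OF \<eta>\<Omega>] factor[OF \<eta>\<Omega>]])
            (use supersolution_quadratic_test[OF super \<eta>\<Omega>] in \<open>auto simp: U_def\<close>)
        then have 2: "- g \<eta> \<le> (\<Sum>k\<in>UNIV. ?r k \<bullet> Y (?r k))"
          using g_eq[OF \<eta>\<Omega>] by simp
        have "(\<Sum>k\<in>UNIV. ?q k \<bullet> X (?q k)) + (\<Sum>k\<in>UNIV. ?r k \<bullet> Y (?r k))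
          \<le> (\<Sum>k\<in>UNIV. \<alpha> * (norm (?q k - ?r k))\<^sup>2 + 1 / \<alpha> * ((norm (?q k))\<^sup>2 + (norm (?r k))\<^sup>2))"
          unfolding sum.distrib[symmetric] by (intro sum_mono XY)
        also have "\<dots> = \<alpha> * (norm (Q \<xi> - Q \<eta>))\<^sup>2 + 1 / \<alpha> * ((norm (Q \<xi>))\<^sup>2 + (norm (Q \<eta>))\<^sup>2)"
        proof -
          have "?q k - ?r k = column k (Q \<xi> - Q \<eta>)" for k by (simp add: column_def vec_eq_iff)
          then show ?thesis
            by (simp only: sum.distrib sum_distrib_left[symmetric] matrix_columns_norm)
        qed
        finally show ?thesis using 1 2 by linarith
      qed
      ultimately show ?thesis using \<xi> \<eta> by blast
    qed
    have "\<forall>j. \<exists>\<xi> \<eta>. \<xi> \<in> K \<and> \<eta> \<in> K \<and>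
        M - c / real (Suc j) \<le> V \<xi> + U \<eta> - real (Suc j) / 6 * (norm (\<xi> - \<eta>))\<^sup>2 \<and>
        (\<xi> \<in> \<Omega> \<longrightarrow> \<eta> \<in> \<Omega> \<longrightarrow> g \<xi> - g \<eta> + 2 * \<epsilon> * (norm (Q \<xi>))\<^sup>2
          \<le> real (Suc j) * (norm (Q \<xi> - Q \<eta>))\<^sup>2 + 1 / real (Suc j) * ((norm (Q \<xi>))\<^sup>2 + (norm (Q \<eta>))\<^sup>2))"
      by (intro allI step) simp
    from choice[OF this] obtain \<xi> where "\<forall>j. \<exists>\<eta>. \<xi> j \<in> K \<and> \<eta> \<in> K \<and>
        M - c / real (Suc j) \<le> V (\<xi> j) + U \<eta> - real (Suc j) / 6 * (norm (\<xi> j - \<eta>))\<^sup>2 \<and>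
        (\<xi> j \<in> \<Omega> \<longrightarrow> \<eta> \<in> \<Omega> \<longrightarrow> g (\<xi> j) - g \<eta> + 2 * \<epsilon> * (norm (Q (\<xi> j)))\<^sup>2
          \<le> real (Suc j) * (norm (Q (\<xi> j) - Q \<eta>))\<^sup>2 + 1 / real (Suc j) * ((norm (Q (\<xi> j)))\<^sup>2 + (norm (Q \<eta>))\<^sup>2))" ..
    from choice[OF this] obtain \<eta> where \<xi>\<eta>: "\<And>j. \<xi> j \<in> K" "\<And>j. \<eta> j \<in> K"
        "\<And>j. M - c / real (Suc j) \<le> V (\<xi> j) + U (\<eta> j) - real (Suc j) / 6 * (norm (\<xi> j - \<eta> j))\<^sup>2"
        "\<And>j. \<xi> j \<in> \<Omega> \<Longrightarrow> \<eta> j \<in> \<Omega> \<Longrightarrow> g (\<xi> j) - g (\<eta> j) + 2 * \<epsilon> * (norm (Q (\<xi> j)))\<^sup>2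
          \<le> real (Suc j) * (norm (Q (\<xi> j) - Q (\<eta> j)))\<^sup>2 + 1 / real (Suc j) * ((norm (Q (\<xi> j)))\<^sup>2 + (norm (Q (\<eta> j)))\<^sup>2)"
      by blast
    obtain l \<sigma> where l: "l \<in> K" and \<sigma>: "strict_mono \<sigma>" and lim: "(\<xi> \<circ> \<sigma>) \<longlonglongrightarrow> l"
      using compK \<xi>\<eta>(1) unfolding compact_def by blast
    define a b \<alpha> where "a n = \<xi> (\<sigma> n)" and "b n = \<eta> (\<sigma> n)" and "\<alpha> n = real (Suc (\<sigma> n))" for n
    have \<alpha>: "\<alpha> n > 0" for n by (simp add: \<alpha>_def)
    have inv\<alpha>: "(\<lambda>n. 1 / \<alpha> n) \<longlonglongrightarrow> 0"
      using LIMSEQ_subseq_LIMSEQ[OF LIMSEQ_Suc[OF lim_1_over_n] \<sigma>] by (simp add: \<alpha>_def o_def)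
    have a: "a \<longlonglongrightarrow> l" using lim by (simp add: a_def[abs_def] o_def)
    have aK: "a n \<in> K" "b n \<in> K" for n using \<xi>\<eta> by (simp_all add: a_def b_def)
    have pen: "M - c / \<alpha> n \<le> V (a n) + U (b n) - \<alpha> n / 6 * (norm (a n - b n))\<^sup>2" for n
      using \<xi>\<eta>(3)[of "\<sigma> n"] by (simp add: a_def b_def \<alpha>_def)
    have key: "g (a n) - g (b n) + 2 * \<epsilon> * (norm (Q (a n)))\<^sup>2
        \<le> \<alpha> n * (norm (Q (a n) - Q (b n)))\<^sup>2 + 1 / \<alpha> n * ((norm (Q (a n)))\<^sup>2 + (norm (Q (b n)))\<^sup>2)"
      if "a n \<in> \<Omega>" "b n \<in> \<Omega>" for n
      using \<xi>\<eta>(4)[of "\<sigma> n"] that by (simp add: a_def b_def \<alpha>_def)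
    have calim: "(\<lambda>n. c / \<alpha> n) \<longlonglongrightarrow> 0"
      using tendsto_mult_left[OF inv\<alpha>, of c] by simp
    have b: "b \<longlonglongrightarrow> l"
    proof -
      obtain xV where xV: "\<forall>y\<in>K. V y \<le> V xV" using usc_on_attains_sup[OF uscV compK K0] by blast
      obtain xU where xU: "\<forall>y\<in>K. U y \<le> U xU" using usc_on_attains_sup[OF uscU compK K0] by blast
      define B where "B = 6 * (V xV + U xU - M)"
      have "norm ((norm (a n - b n))\<^sup>2) \<le> B * (1 / \<alpha> n) + 6 * (1 / \<alpha> n) * (c / \<alpha> n)" for n
      proof -
        have "\<alpha> n / 6 * (norm (a n - b n))\<^sup>2 \<le> V xV + U xU - M + c / \<alpha> n"
          using pen[of n] bspec[OF xV aK(1)[of n]] bspec[OF xU aK(2)[of n]] by linarith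
        then have "6 / \<alpha> n * (\<alpha> n / 6 * (norm (a n - b n))\<^sup>2) \<le> 6 / \<alpha> n * (V xV + U xU - M + c / \<alpha> n)"
          by (rule mult_left_mono) (use \<alpha>[of n] in simp)
        moreover have "6 / \<alpha> n * (\<alpha> n / 6 * (norm (a n - b n))\<^sup>2) = (norm (a n - b n))\<^sup>2"
          using \<alpha>[of n] by simp
        moreover have "6 / \<alpha> n * (V xV + U xU - M + c / \<alpha> n) = B * (1 / \<alpha> n) + 6 * (1 / \<alpha> n) * (c / \<alpha> n)"
          unfolding distrib_left[of "6 / \<alpha> n"] B_def by simp
        ultimately have "(norm (a n - b n))\<^sup>2 \<le> B * (1 / \<alpha> n) + 6 * (1 / \<alpha> n) * (c / \<alpha> n)" by metis
        then show ?thesis by simp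
      qed
      then have "\<forall>\<^sub>F n in sequentially. norm ((norm (a n - b n))\<^sup>2) \<le> B * (1 / \<alpha> n) + 6 * (1 / \<alpha> n) * (c / \<alpha> n)"
        by (rule always_eventually[OF allI])
      moreover have "(\<lambda>n. B * (1 / \<alpha> n) + 6 * (1 / \<alpha> n) * (c / \<alpha> n)) \<longlonglongrightarrow> 0"
        using tendsto_add[OF tendsto_mult_left[OF inv\<alpha>, of B] tendsto_mult[OF tendsto_mult_left[OF inv\<alpha>, of 6] calim]]
        by simp
      ultimately have "(\<lambda>n. (norm (a n - b n))\<^sup>2) \<longlonglongrightarrow> 0"
        by (rule Lim_null_comparison)
      from tendsto_real_sqrt[OF this] have "(\<lambda>n. norm (a n - b n)) \<longlonglongrightarrow> 0"
        by simp
      then have "(\<lambda>n. a n - b n) \<longlonglongrightarrow> 0" by (rule tendsto_norm_zero_cancel)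
      from tendsto_diff[OF a this] show ?thesis by simp
    qed
    \<comment> \<open>This estimate is used twice: with the penalty dropped it shows that
      \<open>l\<close> is a maximum point of \<open>V + U\<close>; then, with the penalty kept, that
      the penalty tends to 0.\<close>
    have near: "\<forall>\<^sub>F n in sequentially. M + \<alpha> n / 6 * (norm (a n - b n))\<^sup>2 \<le> V l + U l + 3 * e"
      if e: "e > 0" for e
    proof -
      have "\<forall>\<^sub>F n in sequentially. V (a n) < V l + e"
        using e by (intro usc_on_eventually_less[OF uscV l _ aK(1) a]) simp
      moreover have "\<forall>\<^sub>F n in sequentially. U (b n) < U l + e"
        using e by (intro usc_on_eventually_less[OF uscU l _ aK(2) b]) simp
      moreover have "\<forall>\<^sub>F n in sequentially. c / \<alpha> n < e"
        using order_tendstoD(2)[OF calim e] .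
      ultimately show ?thesis
      proof eventually_elim
        case (elim n)
        then show ?case using pen[of n] by linarith
      qed
    qed
    have MV: "M \<le> V l + U l"
    proof (rule field_le_epsilon)
      fix e :: real assume "e > 0"
      then obtain n where "M + \<alpha> n / 6 * (norm (a n - b n))\<^sup>2 \<le> V l + U l + 3 * (e / 3)"
        using eventually_happens'[OF sequentially_bot near[of "e / 3"]] by auto
      moreover have "0 \<le> \<alpha> n / 6 * (norm (a n - b n))\<^sup>2" using \<alpha>[of n] by simp
      ultimately show "M \<le> V l + U l + e" by simp
    qed
    have VM: "V l + U l \<le> M" using x0(2)[OF l] by (simp add: M_def)
    have "l \<in> \<Omega>"
    proof (rule ccontr)
      assume "l \<notin> \<Omega>"
      then have "l \<in> frontier \<Omega>" using l assms(1) by (simp add: K_def frontier_def interior_open)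
      then have "v l \<le> u l" using bd by blast
      moreover have "\<epsilon> * (norm l)\<^sup>2 \<le> \<epsilon> * R\<^sup>2"
        using \<epsilon> R(2)[OF l] by (intro mult_left_mono power_mono) auto
      moreover have "\<epsilon> * R\<^sup>2 = m / 2" using R(1) by (simp add: \<epsilon>_def)
      ultimately have "V l + U l \<le> m / 2" by (simp add: V_def U_def)
      then show False using MV mM m by linarith
    qed
    have d0: "(\<lambda>n. \<alpha> n * (norm (a n - b n))\<^sup>2) \<longlonglongrightarrow> 0"
    proof (rule tendstoI)
      fix e :: real assume e: "e > 0"
      \<comment> \<open>Multiplying by 6 leaves 18 e / 36 = e / 2, strictly below
        \<open>e\<close>.\<close>
      have "\<forall>\<^sub>F n in sequentially. M + \<alpha> n / 6 * (norm (a n - b n))\<^sup>2 \<le> V l + U l + 3 * (e / 36)"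
        using near[of "e / 36"] e by simp
      then show "\<forall>\<^sub>F n in sequentially. dist (\<alpha> n * (norm (a n - b n))\<^sup>2) 0 < e"
      proof eventually_elim
        case (elim n)
        have "0 \<le> \<alpha> n * (norm (a n - b n))\<^sup>2" using \<alpha>[of n] by simp
        then show ?case using elim VM e by simp
      qed
    qed
    obtain r L where r: "r > 0" and L: "L-lipschitz_on (ball l r \<inter> \<Omega>) Q"
      using assms(6) \<open>l \<in> \<Omega>\<close> unfolding locally_lipschitz_on_def by blast
    have op: "open (ball l r \<inter> \<Omega>)" "l \<in> ball l r \<inter> \<Omega>" using assms(1) r \<open>l \<in> \<Omega>\<close> by auto
    have ea: "\<forall>\<^sub>F n in sequentially. a n \<in> ball l r \<inter> \<Omega>" by (rule topological_tendstoD[OF a op])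
    have eb: "\<forall>\<^sub>F n in sequentially. b n \<in> ball l r \<inter> \<Omega>" by (rule topological_tendstoD[OF b op])
    have limcomp: "(\<lambda>n. h (s n)) \<longlonglongrightarrow> h l" if "continuous_on \<Omega> h" "s \<longlonglongrightarrow> l" for h :: "_ \<Rightarrow> 'z::topological_space" and s
      using isCont_tendsto_compose[of l h s] that assms(1) \<open>l \<in> \<Omega>\<close>
      by (simp add: continuous_on_eq_continuous_at)
    note ga = limcomp[OF contg a] and gb = limcomp[OF contg b]
    note Na = tendsto_power[OF tendsto_norm[OF limcomp[OF contQ a]], of 2]
      and Nb = tendsto_power[OF tendsto_norm[OF limcomp[OF contQ b]], of 2]
    \<comment> \<open>Both sequences tend to the interior point \<open>l\<close>, so the values of
      \<open>g\<close> cancel in the limit of \<open>key\<close>, while the Lipschitz bound for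
      \<open>Q\<close> reduces the coupling to the vanishing penalty.\<close>
    have "2 * \<epsilon> * (norm (Q l))\<^sup>2 \<le> 0"
    proof (rule tendsto_le[OF sequentially_bot])
      show "(\<lambda>n. g (a n) - g (b n) + 2 * \<epsilon> * (norm (Q (a n)))\<^sup>2) \<longlonglongrightarrow> 2 * \<epsilon> * (norm (Q l))\<^sup>2"
      proof -
        have "(\<lambda>n. g (a n) - g (b n) + 2 * \<epsilon> * (norm (Q (a n)))\<^sup>2) \<longlonglongrightarrow> g l - g l + 2 * \<epsilon> * (norm (Q l))\<^sup>2"
          by (rule tendsto_add[OF tendsto_diff[OF ga gb] tendsto_mult_left[OF Na]])
        then show ?thesis by simp
      qed
      show "(\<lambda>n. L\<^sup>2 * (\<alpha> n * (norm (a n - b n))\<^sup>2) + 1 / \<alpha> n * ((norm (Q (a n)))\<^sup>2 + (norm (Q (b n)))\<^sup>2)) \<longlonglongrightarrow> 0"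
      proof -
        have "(\<lambda>n. L\<^sup>2 * (\<alpha> n * (norm (a n - b n))\<^sup>2) + 1 / \<alpha> n * ((norm (Q (a n)))\<^sup>2 + (norm (Q (b n)))\<^sup>2))
          \<longlonglongrightarrow> L\<^sup>2 * 0 + 0 * ((norm (Q l))\<^sup>2 + (norm (Q l))\<^sup>2)"
          by (rule tendsto_add[OF tendsto_mult_left[OF d0] tendsto_mult[OF inv\<alpha> tendsto_add[OF Na Nb]]])
        then show ?thesis by simp
      qed
      show "\<forall>\<^sub>F n in sequentially. g (a n) - g (b n) + 2 * \<epsilon> * (norm (Q (a n)))\<^sup>2
          \<le> L\<^sup>2 * (\<alpha> n * (norm (a n - b n))\<^sup>2) + 1 / \<alpha> n * ((norm (Q (a n)))\<^sup>2 + (norm (Q (b n)))\<^sup>2)"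
        using ea eb
      proof eventually_elim
        case (elim n)
        have "norm (Q (a n) - Q (b n)) \<le> L * norm (a n - b n)"
          using lipschitz_onD[OF L, of "a n" "b n"] elim by (simp add: dist_norm)
        then have "(norm (Q (a n) - Q (b n)))\<^sup>2 \<le> (L * norm (a n - b n))\<^sup>2" by (intro power_mono) auto
        then have "\<alpha> n * (norm (Q (a n) - Q (b n)))\<^sup>2 \<le> \<alpha> n * (L * norm (a n - b n))\<^sup>2"
          using \<alpha>[of n] by (intro mult_left_mono) auto
        also have "\<dots> = L\<^sup>2 * (\<alpha> n * (norm (a n - b n))\<^sup>2)" by (simp add: power_mult_distrib)
        finally show ?case using key[of n] elim by simp
      qed
    qed
    moreover have "2 * \<epsilon> * (norm (Q l))\<^sup>2 > 0" using \<epsilon> Qnz[OF \<open>l \<in> \<Omega>\<close>] by simp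
    ultimately show False by simp
  qed
qed

end
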